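(* Let $\Gamma$ be a biconnected finite simplicial graph such that the flag complex $\Delta_\Gamma$ is simply connected. If $\Gamma$ has a redundant triangle, then the Bestvina--Brady group $BB_\Gamma$ is not (isomorphic to) an Artin group.
   Context: All graphs are finite simplicial graphs. A graph is biconnected if it is connected and has no cut vertex. The flag complex $\Delta_\Gamma$ is the simplicial complex whose simplices are the nonempty sets of pairwise adjacent vertices of $\Gamma$. The right-angled Artin group on $\Gamma$ is $A_\Gamma=\langle V(\Gamma)\mid [v,w] \text{ whenever } (v,w)\in E(\Gamma)\rangle$, and $BB_\Gamma$ is the kernel of the homomorphism $A_\Gamma\to\mathbb Z$ sending every vertex generator to $1$. An Artin group is a group defined by a finite simplicial graph whose edges carry integer labels $m(e)\ge 2$: generators are the vertices, and each edge $e=(a,b)$ gives the relation $aba\cdots=bab\cdots$ with $m(e)$ letters on each side. The link $\operatorname{lk}(v,\Gamma)$ of a vertex $v$ is the full subgraph induced by the vertices adjacent to $v$. A subgraph $\Lambda\subseteq\Gamma$ is separating if the full subgraph spanned by $V(\Gamma)\setminus V(\Lambda)$ is disconnected. A minimal full separating subgraph is a full separating subgraph none of whose proper full subgraphs is separating in $\Gamma$. Redundant triangle: let $\tau$ be a triangle of $\Delta_\Gamma$ with vertices $v_1,v_2,v_3$, and let $e_j$ be the edge of $\tau$ opposite to $v_j$. Then $\tau$ is redundant if for each $j=1,2,3$ there exists a subgraph $\Lambda_j\subseteq\operatorname{lk}(v_j,\Gamma)$ such that: (1) $e_j\in E(\Lambda_j)$; (2) $\Lambda_j$ is a minimal full separating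 subgraph of $\Gamma$; (3) $\Lambda_1\cap\Lambda_2\cap\Lambda_3$ is the empty subgraph. *)

theory Defs
  imports
    "HOL-Analysis.Analysis"
    "HOL-Algebra.Elementary_Groups"
    "Graph_Theory.Digraph_Component"
begin

section \<open>Finite simplicial graphs\<close>

text \<open>
  A finite simplicial graph is a \<open>graph\<close> in the sense of Graph_Theory: a finite, loop-free,
  symmetric digraph without parallel arcs, an edge being a pair of opposite arcs.
  The library's \<open>connected\<close> excludes the graph without vertices; neither should that graph count
  as disconnected.
\<close>

definition disconnected :: "('a, 'b) pre_digraph \<Rightarrow> bool" where
  "disconnected G \<longleftrightarrow> verts G \<noteq> {} \<and> \<not> Digraph_Component.connected G"

definition cut_vertex :: "('a, 'b) pre_digraph \<Rightarrow> 'a \<Rightarrow> bool" where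
  "cut_vertex G v \<longleftrightarrow> v \<in> verts G \<and> disconnected (G \<restriction> (verts G - {v}))"

definition biconnected :: "('a, 'b) pre_digraph \<Rightarrow> bool" where
  "biconnected G \<longleftrightarrow> Digraph_Component.connected G \<and> (\<nexists>v. cut_vertex G v)"

definition link :: "('a, 'b) pre_digraph \<Rightarrow> 'a \<Rightarrow> ('a, 'b) pre_digraph" where
  "link G v = G \<restriction> {w \<in> verts G. v \<rightarrow>\<^bsub>G\<^esub> w}"

definition separating :: "('a, 'b) pre_digraph \<Rightarrow> ('a, 'b) pre_digraph \<Rightarrow> bool" where
  "separating G H \<longleftrightarrow> subgraph H G \<and> disconnected (G \<restriction> (verts G - verts H))"

definition minimal_full_separating :: "('a, 'b) pre_digraph \<Rightarrow> ('a, 'b) pre_digraph \<Rightarrow> bool" where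
  "minimal_full_separating G H \<longleftrightarrow>
     induced_subgraph H G \<and> separating G H \<and>
     (\<forall>K. induced_subgraph K H \<and> K \<noteq> H \<longrightarrow> \<not> separating G K)"


section \<open>The flag complex\<close>

definition flag_complex :: "('a, 'b) pre_digraph \<Rightarrow> 'a set set" where
  "flag_complex G =
     {S. S \<noteq> {} \<and> S \<subseteq> verts G \<and> (\<forall>u\<in>S. \<forall>v\<in>S. u \<noteq> v \<longrightarrow> u \<rightarrow>\<^bsub>G\<^esub> v)}"

text \<open>
  The geometric realization in barycentric coordinates, as a subspace of the function space
  \<open>'a \<Rightarrow> real\<close> with the product topology. For a finite complex this is the usual topology.
\<close>

definition realization :: "'a set set \<Rightarrow> ('a \<Rightarrow> real) set" where
  "realization K =
     {x. (\<forall>v. 0 \<le> x v) \<and> {v. x v \<noteq> 0} \<in> K \<and> (\<Sum>v | x v \<noteq> 0. x v) = 1}"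

text \<open>
  Since the three subgraphs below are well-formed, their intersection is empty as soon as it
  has no vertices.
\<close>

definition redundant_triangle :: "('a, 'b) pre_digraph \<Rightarrow> 'a \<Rightarrow> 'a \<Rightarrow> 'a \<Rightarrow> bool" where
  "redundant_triangle G v1 v2 v3 \<longleftrightarrow>
     distinct [v1, v2, v3] \<and> {v1, v2, v3} \<in> flag_complex G \<and>
     (\<exists>L1 L2 L3.
        subgraph L1 (link G v1) \<and> subgraph L2 (link G v2) \<and> subgraph L3 (link G v3) \<and>
        v2 \<rightarrow>\<^bsub>L1\<^esub> v3 \<and> v1 \<rightarrow>\<^bsub>L2\<^esub> v3 \<and> v1 \<rightarrow>\<^bsub>L3\<^esub> v2 \<and>
        minimal_full_separating G L1 \<and> minimal_full_separating G L2 \<and>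
        minimal_full_separating G L3 \<and>
        verts L1 \<inter> verts L2 \<inter> verts L3 = {})"


section \<open>Group presentations\<close>

text \<open>
  A word is a list of signed generators, \<open>(x, True)\<close> standing for \<open>x\<close> and \<open>(x, False)\<close> for its
  inverse. A relation \<open>(r, s)\<close> stands for the equation \<open>r = s\<close>; the presented group consists of
  the words modulo the congruence generated by free cancellation and the relations.
\<close>

type_synonym 'a word = "('a \<times> bool) list"

definition words :: "'a set \<Rightarrow> 'a word set" where
  "words X = lists (X \<times> UNIV)"

inductive_set pres_cong :: "'a set \<Rightarrow> ('a word \<times> 'a word) set \<Rightarrow> ('a word \<times> 'a word) set"
  for X :: "'a set" and R :: "('a word \<times> 'a word) set" where
  refl: "w \<in> words X \<Longrightarrow> (w, w) \<in> pres_cong X R"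
| sym: "(u, v) \<in> pres_cong X R \<Longrightarrow> (v, u) \<in> pres_cong X R"
| trans: "(u, v) \<in> pres_cong X R \<Longrightarrow> (v, w) \<in> pres_cong X R \<Longrightarrow> (u, w) \<in> pres_cong X R"
| cancel: "u \<in> words X \<Longrightarrow> v \<in> words X \<Longrightarrow> x \<in> X \<Longrightarrow>
    (u @ [(x, b), (x, \<not> b)] @ v, u @ v) \<in> pres_cong X R"
| rel: "u \<in> words X \<Longrightarrow> v \<in> words X \<Longrightarrow> (r, s) \<in> R \<Longrightarrow> r \<in> words X \<Longrightarrow> s \<in> words X \<Longrightarrow>
    (u @ r @ v, u @ s @ v) \<in> pres_cong X R"

definition presented_group :: "'a set \<Rightarrow> ('a word \<times> 'a word) set \<Rightarrow> 'a word set monoid" where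
  "presented_group X R =
     \<lparr>carrier = words X // pres_cong X R,
      monoid.mult = (\<lambda>A B. \<Union>a\<in>A. \<Union>b\<in>B. pres_cong X R `` {a @ b}),
      one = pres_cong X R `` {[]}\<rparr>"


section \<open>Right-angled Artin groups, Bestvina--Brady groups and Artin groups\<close>

definition commutator_word :: "'a \<Rightarrow> 'a \<Rightarrow> 'a word" where
  "commutator_word v w = [(v, True), (w, True), (v, False), (w, False)]"

definition raag :: "('a, 'b) pre_digraph \<Rightarrow> 'a word set monoid" where
  "raag G = presented_group (verts G) {(commutator_word v w, []) |v w. v \<rightarrow>\<^bsub>G\<^esub> w}"

definition exponent_sum :: "'a word \<Rightarrow> int" where
  "exponent_sum w = (\<Sum>(x, b)\<leftarrow>w. if b then 1 else - 1)"

text \<open>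
  The homomorphism from the right-angled Artin group to the integers sending every generator
  to 1; the exponent sum is constant on the classes.
\<close>

definition raag_height :: "'a word set \<Rightarrow> int" where
  "raag_height A = the_elem (exponent_sum ` A)"

definition bestvina_brady :: "('a, 'b) pre_digraph \<Rightarrow> 'a word set monoid" where
  "bestvina_brady G = (raag G)\<lparr>carrier := kernel (raag G) integer_group raag_height\<rparr>"

text \<open>
  The edge label of \<open>{a, b}\<close> is \<open>m {a, b}\<close>; the values of \<open>m\<close> on other sets are irrelevant.
\<close>

definition labelled_graph :: "('a, 'b) pre_digraph \<Rightarrow> ('a set \<Rightarrow> nat) \<Rightarrow> bool" where
  "labelled_graph G m \<longleftrightarrow> graph G \<and> (\<forall>a b. a \<rightarrow>\<^bsub>G\<^esub> b \<longrightarrow> m {a, b} \<ge> 2)"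

fun alternating_word :: "'a \<Rightarrow> 'a \<Rightarrow> nat \<Rightarrow> 'a word" where
  "alternating_word a b 0 = []"
| "alternating_word a b (Suc n) = (a, True) # alternating_word b a n"

definition artin_group :: "('a, 'b) pre_digraph \<Rightarrow> ('a set \<Rightarrow> nat) \<Rightarrow> 'a word set monoid" where
  "artin_group G m =
     presented_group (verts G)
       {(alternating_word a b (m {a, b}), alternating_word b a (m {a, b})) |a b. a \<rightarrow>\<^bsub>G\<^esub> b}"


section \<open>Basic facts\<close>

lemma words_simps [simp]:
  "[] \<in> words X"
  "(p # w) \<in> words X \<longleftrightarrow> fst p \<in> X \<and> w \<in> words X"
  "u @ v \<in> words X \<longleftrightarrow> u \<in> words X \<and> v \<in> words X"
  by (cases p; auto simp: words_def)+

lemma pres_cong_words: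
  assumes "(u, v) \<in> pres_cong X R" shows "u \<in> words X" "v \<in> words X"
  using assms by induction auto

lemma equiv_pres_cong: "equiv (words X) (pres_cong X R)"
proof (rule equivI)
  show "pres_cong X R \<subseteq> words X \<times> words X"
    using pres_cong_words by fast
  show "refl_on (words X) (pres_cong X R)"
    by (simp add: refl_on_def pres_cong.refl)
  show "Relation.sym (pres_cong X R)"
    by (rule symI) (rule pres_cong.sym)
  show "Relation.trans (pres_cong X R)"
    by (rule transI) (rule pres_cong.trans)
qed

lemma pres_cong_context:
  assumes "(a, b) \<in> pres_cong X R" "u \<in> words X" "v \<in> words X"
  shows "(u @ a @ v, u @ b @ v) \<in> pres_cong X R"
  using assms
proof (induction rule: pres_cong.induct)
  case (cancel u' v' x c)
  then show ?case using pres_cong.cancel[of "u @ u'" X "v' @ v" x c R] by simp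
next
  case (rel u' v' r s)
  then show ?case using pres_cong.rel[of "u @ u'" X "v' @ v" r s R] by simp
next
  case (refl w)
  then show ?case by (intro pres_cong.refl) simp
next
  case (sym a b)
  then show ?case by (blast intro: pres_cong.sym)
next
  case (trans a b c)
  then show ?case by (blast intro: pres_cong.trans)
qed

lemma pres_cong_append:
  assumes "(a, a') \<in> pres_cong X R" "(b, b') \<in> pres_cong X R"
  shows "(a @ b, a' @ b') \<in> pres_cong X R"
proof (rule pres_cong.trans)
  show "(a @ b, a' @ b) \<in> pres_cong X R"
    using pres_cong_context[OF assms(1), of "[]" b] pres_cong_words[OF assms(2)] by simp
  show "(a' @ b, a' @ b') \<in> pres_cong X R"
    using pres_cong_context[OF assms(2), of a' "[]"] pres_cong_words[OF assms(1)] by simp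
qed

lemma presented_group_mult:
  assumes "a \<in> words X" "b \<in> words X"
  shows "(pres_cong X R `` {a}) \<otimes>\<^bsub>presented_group X R\<^esub> (pres_cong X R `` {b}) =
         pres_cong X R `` {a @ b}"
proof -
  let ?C = "\<lambda>w. pres_cong X R `` {w}"
  have *: "?C (a' @ b') = ?C (a @ b)" if "a' \<in> ?C a" "b' \<in> ?C b" for a' b'
    using that equiv_class_eq[OF equiv_pres_cong pres_cong_append] by (metis Image_singleton_iff)
  have "a \<in> ?C a" "b \<in> ?C b"
    using assms by (simp_all add: pres_cong.refl)
  then have "(\<Union>a'\<in>?C a. \<Union>b'\<in>?C b. ?C (a' @ b')) = ?C (a @ b)"
    using * by blast
  then show ?thesis
    by (simp add: presented_group_def)
qed

lemma inverse_word_cong: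
  "w \<in> words X \<Longrightarrow> (rev (map (\<lambda>(x, b). (x, \<not> b)) w) @ w, []) \<in> pres_cong X R"
proof (induction w)
  case Nil
  then show ?case by (auto intro: pres_cong.refl)
next
  case (Cons p w)
  let ?i = "rev (map (\<lambda>(x, b). (x, \<not> b)) w)"
  obtain x b where p: "p = (x, b)" by (cases p)
  have "?i \<in> words X" using Cons.prems by (auto simp: words_def)
  then have "(?i @ [(x, \<not> b), (x, \<not> \<not> b)] @ w, ?i @ w) \<in> pres_cong X R"
    using Cons.prems p by (intro pres_cong.cancel) auto
  then have "(?i @ [(x, \<not> b)] @ (x, b) # w, ?i @ w) \<in> pres_cong X R" by simp
  moreover have "(?i @ w, []) \<in> pres_cong X R" using Cons by simp
  ultimately show ?case using p by (auto dest: pres_cong.trans)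
qed

theorem group_presented_group: "group (presented_group X R)"
proof -
  let ?G = "presented_group X R"
  have car: "carrier ?G = (\<lambda>w. pres_cong X R `` {w}) ` words X"
    by (auto simp: presented_group_def quotient_def)
  have one: "\<one>\<^bsub>?G\<^esub> = pres_cong X R `` {[]}"
    by (simp add: presented_group_def)
  show ?thesis
  proof (rule groupI)
    fix A assume "A \<in> carrier ?G"
    then obtain w where w: "w \<in> words X" "A = pres_cong X R `` {w}" using car by auto
    let ?i = "rev (map (\<lambda>(x, b). (x, \<not> b)) w)"
    have i: "?i \<in> words X" using w(1) by (auto simp: words_def)
    show "\<exists>B\<in>carrier ?G. B \<otimes>\<^bsub>?G\<^esub> A = \<one>\<^bsub>?G\<^esub>"
      using i w presented_group_mult[OF i w(1), of R] car one
        equiv_class_eq[OF equiv_pres_cong inverse_word_cong[OF w(1), of R]]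
      by (intro bexI[of _ "pres_cong X R `` {?i}"]) auto
  qed (auto simp: car one presented_group_mult)
qed

lemma exponent_sum_append [simp]: "exponent_sum (u @ v) = exponent_sum u + exponent_sum v"
  by (simp add: exponent_sum_def)

lemma exponent_sum_raag_cong:
  assumes "(u, v) \<in> pres_cong X {(commutator_word v w, []) |v w. E v w}"
  shows "exponent_sum u = exponent_sum v"
  using assms by induction (auto simp: exponent_sum_def commutator_word_def)

abbreviation raag_class :: "('a, 'b) pre_digraph \<Rightarrow> 'a word \<Rightarrow> 'a word set" where
  "raag_class G w \<equiv>
     pres_cong (verts G) {(commutator_word v w, []) |v w. v \<rightarrow>\<^bsub>G\<^esub> w} `` {w}"

lemma raag_height_class:
  assumes "w \<in> words (verts G)"
  shows "raag_height (raag_class G w) = exponent_sum w"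
proof -
  have "exponent_sum ` raag_class G w = {exponent_sum w}"
    using assms exponent_sum_raag_cong by (fastforce intro: pres_cong.refl)
  then show ?thesis by (simp add: raag_height_def)
qed

corollary raag_height_generator:
  "v \<in> verts G \<Longrightarrow> raag_height (raag_class G [(v, True)]) = 1"
  by (simp add: raag_height_class exponent_sum_def)

theorem raag_height_hom: "raag_height \<in> hom (raag G) integer_group"
proof (rule homI)
  fix A B assume "A \<in> carrier (raag G)" "B \<in> carrier (raag G)"
  then obtain a b where "a \<in> words (verts G)" "A = raag_class G a"
    "b \<in> words (verts G)" "B = raag_class G b"
    by (auto simp: raag_def presented_group_def quotient_def)
  then show "raag_height (A \<otimes>\<^bsub>raag G\<^esub> B) = raag_height A \<otimes>\<^bsub>integer_group\<^esub> raag_height B"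
    by (simp add: raag_def presented_group_mult raag_height_class integer_group_def)
qed (simp add: integer_group_def)

theorem group_bestvina_brady: "group (bestvina_brady G)"
proof -
  have "group (raag G)"
    by (simp add: raag_def group_presented_group)
  then interpret group_hom "raag G" integer_group raag_height
    by (simp add: group_hom_def group_hom_axioms_def raag_height_hom)
  show ?thesis
    unfolding bestvina_brady_def using \<open>group (raag G)\<close>
    by (intro subgroup.subgroup_is_group subgroup_kernel)
qed

end

theory Submission
  imports Defs "HOL-Complex_Analysis.Winding_Numbers"
begin

text \<open>
  Call a homomorphism \<open>a\<close> from a group to the reals resonant if there is a homomorphism \<open>b\<close>,
  independent of \<open>a\<close>, whose cup product with \<open>a\<close> vanishes. In an Artin group, homomorphisms to
  the reals are functions on the vertices that agree along odd edges, and \<open>a\<close>, \<open>b\<close> have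
  vanishing cup product iff \<open>a x * b y = a y * b x\<close> on all edges. Hence the resonant homomorphisms
  form a union of coordinate subspaces.

  In the Bestvina--Brady group, those homomorphisms that are constant on a minimal full separating
  subgraph \<open>L\<close> are a maximal linear space of resonant ones: a resonant homomorphism that is
  nonconstant on all edges outside \<open>L\<close> yields a partition of the remaining edges by direction,
  and since the flag complex has no first cohomology, a connected set of vertices where two
  directions meet separates the graph, so it is \<open>L\<close>. An isomorphism with an Artin group would
  thus turn the three spaces of the redundant triangle into coordinate subspaces. These would
  satisfy the distributive law, which fails for the indicator function of \<open>L1 \<inter> L2\<close>.
\<close>

section \<open>Commuting elements of groups\<close>

text \<open>Cup products never occur as such. That the product of \<open>a\<close> and
  \<open>b\<close> vanishes is expressed by a lift of the pair to the real Heisenberg group. Images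
  of commuting elements commute there, so the relations of the kernel at a triangle say that the
  potentials of \<open>a\<close> and \<open>b\<close> send its corners to collinear points of the
  plane.

  Simple connectivity enters only to make integral cocycles coboundaries. This is read off from
  winding numbers of a circle-valued map on the realization. Biconnectedness ensures that the
  connected set where two directions meet is not a single vertex.

  The obstacle is that the vertices of the supposed Artin graph cannot be seen in the kernel. What
  is transported along the isomorphism is therefore a weak structure: a finite set of elements whose
  values serve as coordinates, such that coordinates can be switched off and resonance passes to
  smaller nonzero supports. Each separator space is then recovered as the homomorphisms supported
  inside the support of a single one.\<close>

context group
begin

lemma inv_mult_cancel:
  assumes "x \<in> carrier G" "y \<in> carrier G"
  shows "inv x \<otimes> (x \<otimes> y) = y" "x \<otimes> (inv x \<otimes> y) = y"
  using assms by (simp_all flip: m_assoc)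

lemmas word_simps = m_assoc inv_mult_cancel inv_mult_group

lemma commute_inv:
  assumes "x \<in> carrier G" "y \<in> carrier G" "x \<otimes> y = y \<otimes> x"
  shows "inv x \<otimes> y = y \<otimes> inv x"
proof -
  have "inv x \<otimes> (y \<otimes> x) \<otimes> inv x = inv x \<otimes> (x \<otimes> y) \<otimes> inv x" by (simp only: assms(3))
  then show ?thesis using assms(1,2) by (simp add: word_simps)
qed

lemma commute_int_pow:
  assumes "x \<in> carrier G" "y \<in> carrier G" "x \<otimes> y = y \<otimes> x"
  shows "x [^] (k::int) \<otimes> y = y \<otimes> x [^] k"
proof (cases k rule: int_cases2)
  case (nonneg n)
  show ?thesis
    unfolding nonneg int_pow_int by (rule group_commutes_pow[OF assms(3,1,2)])
next
  case (nonpos n)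
  show ?thesis
    unfolding nonpos int_pow_neg_int[OF assms(1)]
    by (rule commute_inv[OF nat_pow_closed[OF assms(1)] assms(2) group_commutes_pow[OF assms(3,1,2)]])
qed

text \<open>Meant for the generators at the corners of a triangle: their differences commute inside
  the kernel, which is the source of the collinearity condition on potentials.\<close>

lemma diff_commute:
  assumes c: "x \<in> carrier G" "y \<in> carrier G" "z \<in> carrier G"
    and "x \<otimes> y = y \<otimes> x" "y \<otimes> z = z \<otimes> y" "x \<otimes> z = z \<otimes> x"
  shows "(x \<otimes> inv y) \<otimes> (y \<otimes> inv z) = (y \<otimes> inv z) \<otimes> (x \<otimes> inv y)"
proof -
  have "(y \<otimes> inv z) \<otimes> (x \<otimes> inv y) = (inv z \<otimes> y) \<otimes> (x \<otimes> inv y)"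
    using commute_inv[of z y] assms by simp
  also have "\<dots> = inv z \<otimes> (y \<otimes> x) \<otimes> inv y" using c by (simp add: m_assoc)
  also have "\<dots> = inv z \<otimes> (x \<otimes> y) \<otimes> inv y" using assms(4) by simp
  also have "\<dots> = inv z \<otimes> x" using c by (simp add: m_assoc)
  also have "\<dots> = x \<otimes> inv z" using commute_inv[of z x] assms by simp
  finally show ?thesis using c by (simp add: word_simps)
qed

text \<open>Because \<open>y\<close> centralises \<open>d\<close>, it can be slipped into the
  conjugation. For equal powers of two generators the new conjugator has height zero, so a real
  homomorphism on the kernel does not notice it.\<close>

lemma conjugate_shift:
  assumes "x \<in> carrier G" "y \<in> carrier G" "d \<in> carrier G" "y \<otimes> d = d \<otimes> y"
  shows "x \<otimes> d \<otimes> inv x = (x \<otimes> inv y) \<otimes> d \<otimes> inv (x \<otimes> inv y)"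
proof -
  have "(x \<otimes> inv y) \<otimes> d \<otimes> inv (x \<otimes> inv y) = x \<otimes> (inv y \<otimes> d) \<otimes> y \<otimes> inv x"
    using assms(1-3) by (simp add: word_simps)
  also have "\<dots> = x \<otimes> (d \<otimes> inv y) \<otimes> y \<otimes> inv x"
    using commute_inv[OF assms(2-4)] by simp
  finally show ?thesis using assms(1-3) by (simp add: word_simps)
qed

end

section \<open>Connectivity of graphs\<close>

lemma dominates_induce_subgraph_iff:
  "u \<rightarrow>\<^bsub>G \<restriction> S\<^esub> v \<longleftrightarrow> u \<rightarrow>\<^bsub>G\<^esub> v \<and> u \<in> S \<and> v \<in> S"
  by (auto simp: arcs_ends_conv)

lemma graph_dominates_sym: "graph G \<Longrightarrow> u \<rightarrow>\<^bsub>G\<^esub> v \<Longrightarrow> v \<rightarrow>\<^bsub>G\<^esub> u"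
  by (rule sym_digraph.graph_symmetric) (auto simp: graph_def pseudo_graph_def)

lemma graph_dominates_verts:
  assumes "graph G" "u \<rightarrow>\<^bsub>G\<^esub> v" shows "u \<in> verts G" "v \<in> verts G" "u \<noteq> v"
proof -
  interpret graph G by fact
  show "u \<in> verts G" "v \<in> verts G" "u \<noteq> v"
    using assms(2) adj_in_verts adj_not_same by auto
qed

lemma finite_verts_graph: "graph G \<Longrightarrow> finite (verts G)"
  by (simp add: graph_def digraph_def fin_digraph.finite_verts)

text \<open>Trades walks for sets closed under adjacency, which suits both uses below: induction
  along edges and exhibiting disconnections.\<close>

lemma (in sym_digraph) connected_iff_closed_sets:
  "Digraph_Component.connected G \<longleftrightarrow> verts G \<noteq> {} \<and>
    (\<forall>A. A \<subseteq> verts G \<longrightarrow> A \<noteq> {} \<longrightarrow> (\<forall>u v. u \<in> A \<longrightarrow> u \<rightarrow> v \<longrightarrow> v \<in> A) \<longrightarrow> A = verts G)"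
    (is "_ \<longleftrightarrow> _ \<and> ?closed")
proof -
  have "Digraph_Component.connected G \<longleftrightarrow> verts G \<noteq> {} \<and> (\<forall>u\<in>verts G. \<forall>v\<in>verts G. u \<rightarrow>\<^sup>* v)"
    by (simp add: Digraph_Component.connected_def strongly_connected_def
        reachable_mk_symmetric_eq[OF sym_arcs])
  moreover have "(\<forall>u\<in>verts G. \<forall>v\<in>verts G. u \<rightarrow>\<^sup>* v) \<longleftrightarrow> ?closed"
  proof (intro iffI ballI allI impI)
    fix A assume r: "\<forall>u\<in>verts G. \<forall>v\<in>verts G. u \<rightarrow>\<^sup>* v"
      and A: "A \<subseteq> verts G" "A \<noteq> {}" "\<forall>u v. u \<in> A \<longrightarrow> u \<rightarrow> v \<longrightarrow> v \<in> A"
    from A(2) obtain u where u: "u \<in> A" by blast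
    have "v \<in> A" if "u \<rightarrow>\<^sup>* v" for v
      using that by (induction rule: reachable_induct) (use u A in auto)
    then show "A = verts G" using r u A(1) by blast
  next
    fix u v assume c: ?closed and uv: "u \<in> verts G" "v \<in> verts G"
    have "{w. u \<rightarrow>\<^sup>* w} = verts G"
      using c uv(1) by (elim allE[of _ "{w. u \<rightarrow>\<^sup>* w}"])
        (auto elim: reachable_in_vertsE intro: reachable_adj_trans)
    then show "u \<rightarrow>\<^sup>* v" using uv by blast
  qed
  ultimately show ?thesis by (simp only:)
qed

lemma connected_closed_set:
  assumes "graph G" "Digraph_Component.connected G" "u \<in> verts G" "P u"
    and "\<And>v w. v \<rightarrow>\<^bsub>G\<^esub> w \<Longrightarrow> P v \<Longrightarrow> P w" and "x \<in> verts G"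
  shows "P x"
proof -
  interpret graph G by fact
  let ?A = "{v \<in> verts G. P v}"
  have "?A = verts G"
  proof (rule assms(2)[unfolded connected_iff_closed_sets, THEN conjunct2, rule_format])
    show "?A \<subseteq> verts G" "?A \<noteq> {}" using assms(3,4) by auto
    fix v w assume "v \<in> ?A" "v \<rightarrow>\<^bsub>G\<^esub> w"
    then show "w \<in> ?A" using assms(5)[of v w] adj_in_verts(2)[of v w] by simp
  qed
  then show ?thesis using assms(6) by blast
qed

text \<open>\<open>A\<close> is a union of components. Its being nonempty also gives
  \<open>S \<noteq> {}\<close>, which \<open>disconnected\<close> demands.\<close>

lemma disconnected_induce_iff:
  assumes "graph G" "S \<subseteq> verts G"
  shows "disconnected (G \<restriction> S) \<longleftrightarrow>
    (\<exists>A. A \<subseteq> S \<and> A \<noteq> {} \<and> A \<noteq> S \<and> (\<forall>u\<in>A. \<forall>v\<in>S. u \<rightarrow>\<^bsub>G\<^esub> v \<longrightarrow> v \<in> A))"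
proof -
  interpret sym_digraph "G \<restriction> S"
  proof
    show "symmetric (G \<restriction> S)"
      using graph_dominates_sym[OF assms(1)]
      by (auto simp: symmetric_def dominates_induce_subgraph_iff intro!: symI)
  qed auto
  have *: "(\<forall>u v. u \<in> A \<longrightarrow> u \<rightarrow>\<^bsub>G \<restriction> S\<^esub> v \<longrightarrow> v \<in> A) \<longleftrightarrow> (\<forall>u\<in>A. \<forall>v\<in>S. u \<rightarrow>\<^bsub>G\<^esub> v \<longrightarrow> v \<in> A)"
    if "A \<subseteq> S" for A
    using that by (auto simp: dominates_induce_subgraph_iff)
  show ?thesis
    unfolding disconnected_def connected_iff_closed_sets induce_subgraph_verts
  proof (intro iffI)
    assume "S \<noteq> {} \<and> \<not> (S \<noteq> {} \<and> (\<forall>A. A \<subseteq> S \<longrightarrow> A \<noteq> {} \<longrightarrow>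
      (\<forall>u v. u \<in> A \<longrightarrow> u \<rightarrow>\<^bsub>G \<restriction> S\<^esub> v \<longrightarrow> v \<in> A) \<longrightarrow> A = S))"
    then obtain A where "A \<subseteq> S" "A \<noteq> {}" "A \<noteq> S" "\<forall>u v. u \<in> A \<longrightarrow> u \<rightarrow>\<^bsub>G \<restriction> S\<^esub> v \<longrightarrow> v \<in> A"
      by metis
    with * show "\<exists>A\<subseteq>S. A \<noteq> {} \<and> A \<noteq> S \<and> (\<forall>u\<in>A. \<forall>v\<in>S. u \<rightarrow>\<^bsub>G\<^esub> v \<longrightarrow> v \<in> A)" by metis
  next
    assume "\<exists>A\<subseteq>S. A \<noteq> {} \<and> A \<noteq> S \<and> (\<forall>u\<in>A. \<forall>v\<in>S. u \<rightarrow>\<^bsub>G\<^esub> v \<longrightarrow> v \<in> A)"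
    then obtain A where "A \<subseteq> S" "A \<noteq> {}" "A \<noteq> S" "\<forall>u v. u \<in> A \<longrightarrow> u \<rightarrow>\<^bsub>G \<restriction> S\<^esub> v \<longrightarrow> v \<in> A"
      using * by metis
    then show "S \<noteq> {} \<and> \<not> (S \<noteq> {} \<and> (\<forall>A. A \<subseteq> S \<longrightarrow> A \<noteq> {} \<longrightarrow>
      (\<forall>u v. u \<in> A \<longrightarrow> u \<rightarrow>\<^bsub>G \<restriction> S\<^esub> v \<longrightarrow> v \<in> A) \<longrightarrow> A = S))"
      by blast
  qed
qed

section \<open>Cocycles on simply connected flag complexes\<close>

definition simplex_coords :: "'a \<Rightarrow> 'a \<Rightarrow> real" where
  "simplex_coords v = (\<lambda>w. if w = v then 1 else 0)"

definition edge_path :: "'a \<Rightarrow> 'a \<Rightarrow> real \<Rightarrow> 'a \<Rightarrow> real" where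
  "edge_path u v t = (\<lambda>w. (1 - t) * simplex_coords u w + t * simplex_coords v w)"

text \<open>The path is closed only for integral \<open>c\<close>, but the winding number of an open
  valid path is still the normalised integral of \<open>1 / z\<close>, whose integrand is constant
  here.\<close>

lemma winding_number_exp_linear:
  "winding_number (\<lambda>t. exp (2 * of_real pi * \<i> * of_real (t * c))) 0 = of_real c"
proof -
  let ?g = "\<lambda>t::real. exp (2 * of_real pi * \<i> * of_real (t * c)) :: complex"
  have d: "(?g has_vector_derivative (2 * of_real pi * \<i> * of_real c * ?g t)) (at t within S)" for t S
  proof -
    have "((\<lambda>z. exp (2 * of_real pi * \<i> * (z * of_real c))) has_field_derivative
        2 * of_real pi * \<i> * of_real c * exp (2 * of_real pi * \<i> * (of_real t * of_real c)))
        (at (of_real t :: complex))"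
      by (auto intro!: derivative_eq_intros)
    from has_vector_derivative_real_field[OF this] show ?thesis by simp
  qed
  have C1: "?g C1_differentiable_on {0..1}"
    unfolding C1_differentiable_on_def
    by (rule exI[of _ "\<lambda>t. 2 * of_real pi * \<i> * of_real c * ?g t"]) (intro conjI ballI d, intro continuous_intros)
  have v: "valid_path ?g"
    unfolding valid_path_def by (rule C1_differentiable_imp_piecewise[OF C1])
  have nz: "0 \<notin> path_image ?g" by (auto simp: path_image_def)
  have "((\<lambda>w. 1 / (w - 0)) has_contour_integral (2 * of_real pi * \<i> * of_real c)) ?g"
    unfolding has_contour_integral_def
  proof (rule has_integral_eq[where f="\<lambda>_. 2 * of_real pi * \<i> * of_real c"])
    fix x :: real assume "x \<in> {0..1}"
    then have "vector_derivative ?g (at x within {0..1}) = 2 * of_real pi * \<i> * of_real c * ?g x"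
      by (intro vector_derivative_within_closed_interval d) auto
    then show "2 * of_real pi * \<i> * of_real c
        = 1 / (?g x - 0) * vector_derivative ?g (at x within {0..1})"
      by simp
  next
    show "((\<lambda>_. 2 * of_real pi * \<i> * of_real c) has_integral 2 * of_real pi * \<i> * of_real c) {0..1::real}"
      using has_integral_const_real[of "2 * of_real pi * \<i> * of_real c :: complex" 0 1] by simp
  qed
  then show ?thesis
    using winding_number_valid_path[OF v nz] contour_integral_unique by fastforce
qed

context
  fixes G :: "('a, 'b) pre_digraph" and \<theta> :: "'a \<Rightarrow> 'a \<Rightarrow> int"
  assumes G: "graph G"
    and cocycle: "\<And>u v w. {u, v, w} \<in> flag_complex G \<Longrightarrow> \<theta> u v + \<theta> v w = \<theta> u w"
begin

text \<open>A circle-valued map representing the class of \<theta>: with base vertex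
  \<open>v\<close> the exponent is the affine function taking the value \<open>\<theta> v w\<close>
  at \<open>w\<close>. The arbitrary base in the support is harmless because \<theta> is
  integral.\<close>

definition cocycle_map :: "('a \<Rightarrow> real) \<Rightarrow> complex" where
  "cocycle_map x =
     exp (2 * of_real pi * \<i> * of_real (\<Sum>w\<in>verts G. x w * of_int (\<theta> (SOME v. x v \<noteq> 0) w)))"

text \<open>Barycentric coordinates sum to 1, so by the cocycle identity a change of base from
  \<open>u\<close> to \<open>v\<close> shifts the sum by the integer \<open>\<theta> u v\<close>,
  which the exponential ignores.\<close>

lemma cocycle_map_eq:
  assumes x: "x \<in> realization (flag_complex G)" and v: "x v \<noteq> 0"
  shows "cocycle_map x = exp (2 * of_real pi * \<i> * of_real (\<Sum>w\<in>verts G. x w * of_int (\<theta> v w)))"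
proof -
  define u where "u = (SOME v. x v \<noteq> 0)"
  have u: "x u \<noteq> 0" unfolding u_def using v by (rule someI)
  let ?S = "{w. x w \<noteq> 0}"
  have S: "?S \<in> flag_complex G" "(\<Sum>w\<in>?S. x w) = 1" using x by (auto simp: realization_def)
  have sub: "{u, v, w} \<in> flag_complex G" if "x w \<noteq> 0" for w
    using S(1) u v that by (auto simp: flag_complex_def)
  have fin: "finite (verts G)"
    using G by (simp add: graph_def digraph_def fin_digraph.finite_verts)
  have SV: "?S \<subseteq> verts G" using S(1) by (auto simp: flag_complex_def)
  have "(\<Sum>w\<in>verts G. x w) = 1"
    using S(2) sum.mono_neutral_left[OF fin SV, of x] by auto
  moreover have "x w * of_int (\<theta> u w) = x w * of_int (\<theta> u v) + x w * of_int (\<theta> v w)" for w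
  proof (cases "x w = 0")
    case False
    from cocycle[OF sub[OF this]] have "real_of_int (\<theta> u w) = of_int (\<theta> u v) + of_int (\<theta> v w)" by linarith
    then show ?thesis by (simp add: algebra_simps)
  qed simp
  ultimately have *: "(\<Sum>w\<in>verts G. x w * of_int (\<theta> u w)) =
      of_int (\<theta> u v) + (\<Sum>w\<in>verts G. x w * of_int (\<theta> v w))"
    by (simp add: sum.distrib flip: sum_distrib_right)
  have "exp (2 * of_real pi * \<i> * of_int (\<theta> u v)) = (1::complex)"
    using exp_integer_2pi[of "of_int (\<theta> u v)"] by (simp add: mult_ac)
  then show ?thesis
    unfolding cocycle_map_def u_def[symmetric] * by (simp add: distrib_left exp_add)
qed

text \<open>The chosen base vertex does not vary continuously. On the open set where
  \<open>x v \<noteq> 0\<close>, however, the base can be fixed at \<open>v\<close>, and these sets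
  cover the realization.\<close>

lemma continuous_on_cocycle_map: "continuous_on (realization (flag_complex G)) cocycle_map"
proof -
  let ?S = "realization (flag_complex G)"
  let ?T = "\<lambda>v. {x::'a \<Rightarrow> real. x v \<noteq> 0}"
  have op: "open (?T v)" for v :: 'a
  proof -
    have "continuous_on UNIV (\<lambda>x::'a \<Rightarrow> real. x v)" by (rule continuous_on_product_coordinates)
    then have "open ((\<lambda>x::'a \<Rightarrow> real. x v) -` (- {0}))" by (intro open_vimage) auto
    moreover have "(\<lambda>x::'a \<Rightarrow> real. x v) -` (- {0}) = ?T v" by auto
    ultimately show ?thesis by simp
  qed
  have coord: "continuous_on A (\<lambda>x::'a \<Rightarrow> real. x w)" for A w
    by (rule continuous_on_subset[OF continuous_on_product_coordinates]) simp
  have c: "continuous_on (?S \<inter> ?T v) cocycle_map" for v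
  proof (rule continuous_on_eq)
    show "continuous_on (?S \<inter> ?T v)
      (\<lambda>x. exp (2 * of_real pi * \<i> * of_real (\<Sum>w\<in>verts G. x w * of_int (\<theta> v w))))"
      by (intro continuous_on_exp continuous_on_mult continuous_on_const continuous_on_of_real
          continuous_on_sum coord)
  qed (auto simp: cocycle_map_eq)
  have "continuous_on (\<Union>v. ?S \<inter> ?T v) cocycle_map"
    unfolding continuous_on_def
  proof safe
    fix x v assume x: "x \<in> ?S" "x v \<noteq> 0"
    have "(\<Union>v. ?S \<inter> ?T v) \<inter> ?T v = (?S \<inter> ?T v) \<inter> ?T v" by auto
    then have "at x within (\<Union>v. ?S \<inter> ?T v) = at x within (?S \<inter> ?T v)"
      using x op by (intro at_within_nhd[of _ "?T v"]) auto
    then show "(cocycle_map \<longlongrightarrow> cocycle_map x) (at x within (\<Union>v. ?S \<inter> ?T v))"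
      using c[of v] x unfolding continuous_on_def by auto
  qed
  moreover have "(\<Union>v. ?S \<inter> ?T v) = ?S"
    by (auto simp: realization_def flag_complex_def)
  ultimately show ?thesis by simp
qed

lemma cocycle_map_nonzero: "cocycle_map x \<noteq> 0"
  by (simp add: cocycle_map_def)

lemma cocycle_degenerate: "v \<in> verts G \<Longrightarrow> \<theta> v v = 0"
  using cocycle[of v v v] by (simp add: flag_complex_def)

lemma edge_in_flag_complex: "u \<rightarrow>\<^bsub>G\<^esub> v \<Longrightarrow> {u, v} \<in> flag_complex G"
  using graph_dominates_verts[OF G] graph_dominates_sym[OF G] by (auto simp: flag_complex_def)

lemma edge_path_in_realization:
  assumes "u \<rightarrow>\<^bsub>G\<^esub> v" "t \<in> {0..1}"
  shows "edge_path u v t \<in> realization (flag_complex G)"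
proof -
  have uv: "u \<in> verts G" "v \<in> verts G" "u \<noteq> v" using graph_dominates_verts[OF G assms(1)] by auto
  have supp: "{w. edge_path u v t w \<noteq> 0} = (if t = 0 then {u} else if t = 1 then {v} else {u, v})"
    using uv by (auto simp: edge_path_def simplex_coords_def)
  have "{w. edge_path u v t w \<noteq> 0} \<in> flag_complex G"
    unfolding supp using edge_in_flag_complex[OF assms(1)] uv by (auto simp: flag_complex_def)
  moreover have "(\<Sum>w | edge_path u v t w \<noteq> 0. edge_path u v t w) = 1"
    unfolding supp using uv(3) by (auto simp: edge_path_def simplex_coords_def)
  ultimately show ?thesis
    using assms(2) by (auto simp: realization_def edge_path_def simplex_coords_def)
qed

lemma cocycle_map_edge_path:
  assumes "u \<rightarrow>\<^bsub>G\<^esub> v" "t \<in> {0..1}"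
  shows "cocycle_map (edge_path u v t) = exp (2 * of_real pi * \<i> * of_real (t * of_int (\<theta> u v)))"
proof -
  have uv: "u \<in> verts G" "v \<in> verts G" "u \<noteq> v" using graph_dominates_verts[OF G assms(1)] by auto
  have sum: "(\<Sum>w\<in>verts G. edge_path u v t w * of_int (\<theta> x w))
      = (1 - t) * of_int (\<theta> x u) + t * of_int (\<theta> x v)" for x
  proof -
    have "edge_path u v t w * of_int (\<theta> x w) =
      (if w = u then (1 - t) * of_int (\<theta> x u) else 0) + (if w = v then t * of_int (\<theta> x v) else 0)" for w
      using uv(3) by (auto simp: edge_path_def simplex_coords_def)
    then show ?thesis using uv finite_verts_graph[OF G] by (simp add: sum.distrib sum.delta)
  qed
  note eq = cocycle_map_eq[OF edge_path_in_realization[OF assms]]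
  show ?thesis
  \<comment> \<open>At the end of the edge \<open>u\<close> has left the support and the base must
    be \<open>v\<close>; both sides are then 1, by integrality.\<close>
  proof (cases "t = 1")
    case True
    then have "edge_path u v t v \<noteq> 0" using uv by (simp add: edge_path_def simplex_coords_def)
    moreover have "exp (2 * of_real pi * \<i> * of_int (\<theta> u v)) = (1::complex)"
      using exp_integer_2pi[of "of_int (\<theta> u v)"] by (simp add: mult_ac)
    ultimately show ?thesis using True uv eq[of v] unfolding sum by (simp add: cocycle_degenerate)
  next
    case False
    then have "edge_path u v t u \<noteq> 0" using uv by (simp add: edge_path_def simplex_coords_def)
    then show ?thesis using uv by (simp add: eq sum cocycle_degenerate)
  qed
qed

lemma path_image_edge_path:
  "u \<rightarrow>\<^bsub>G\<^esub> v \<Longrightarrow> path_image (edge_path u v) \<subseteq> realization (flag_complex G)"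
  unfolding path_image_def using edge_path_in_realization by blast

lemma path_edge_path:
  "path (edge_path u v)" "pathstart (edge_path u v) = simplex_coords u"
  "pathfinish (edge_path u v) = simplex_coords v"
proof -
  show "path (edge_path u v)"
    unfolding path_def
    by (rule continuous_on_coordinatewise_then_product) (simp add: edge_path_def, intro continuous_intros)
qed (auto simp: edge_path_def pathstart_def pathfinish_def)

abbreviation winding :: "(real \<Rightarrow> 'a \<Rightarrow> real) \<Rightarrow> complex" where
  "winding p \<equiv> winding_number (cocycle_map \<circ> p) 0"

lemma winding_edge_path:
  assumes "u \<rightarrow>\<^bsub>G\<^esub> v" shows "winding (edge_path u v) = of_int (\<theta> u v)"
proof -
  have "winding (edge_path u v) =
      winding_number (\<lambda>t. exp (2 * of_real pi * \<i> * of_real (t * of_int (\<theta> u v)))) 0"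
    by (rule winding_number_cong) (simp add: cocycle_map_edge_path[OF assms])
  then show ?thesis unfolding winding_number_exp_linear by simp
qed

lemma path_cocycle_map:
  assumes "path p" "path_image p \<subseteq> realization (flag_complex G)"
  shows "path (cocycle_map \<circ> p)" "0 \<notin> path_image (cocycle_map \<circ> p)"
  using assms continuous_on_cocycle_map continuous_on_subset path_continuous_image
  by (blast, auto simp: path_image_def cocycle_map_nonzero)

lemma winding_join:
  assumes "path p" "path_image p \<subseteq> realization (flag_complex G)"
    and "path q" "path_image q \<subseteq> realization (flag_complex G)" and "pathfinish p = pathstart q"
  shows "winding (p +++ q) = winding p + winding q"
  unfolding path_compose_join
  using assms path_cocycle_map[OF assms(1,2)] path_cocycle_map[OF assms(3,4)]
  by (intro winding_number_join) (auto simp: pathfinish_compose pathstart_compose)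

text \<open>\<open>p\<close> followed by the reverse of \<open>q\<close> is a contractible loop, and
  its image under \<open>cocycle_map\<close> contracts without meeting 0.\<close>

lemma winding_unique:
  assumes S: "simply_connected (realization (flag_complex G))"
    and p: "path p" "path_image p \<subseteq> realization (flag_complex G)"
    and q: "path q" "path_image q \<subseteq> realization (flag_complex G)"
    and ends: "pathstart p = pathstart q" "pathfinish p = pathfinish q"
  shows "winding p = winding q"
proof -
  let ?S = "realization (flag_complex G)"
  let ?l = "p +++ reversepath q" and ?c = "\<lambda>_::real. pathstart p"
  have r: "path (reversepath q)" "path_image (reversepath q) \<subseteq> ?S"
    using q by auto
  have l: "path ?l" "path_image ?l \<subseteq> ?S" "pathfinish ?l = pathstart ?l"
    using p r ends by (auto simp: subset_path_image_join)
  have "pathstart p \<in> ?S" using p(2) pathstart_in_path_image by blast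
  then have c: "path ?c" "path_image ?c \<subseteq> ?S" "pathfinish ?c = pathstart ?c"
    by (auto simp: path_def path_image_def pathstart_def pathfinish_def)
  have "homotopic_loops ?S ?l ?c"
    using S l c unfolding simply_connected_def by blast
  then have "homotopic_loops (- {0}) (cocycle_map \<circ> ?l) (cocycle_map \<circ> ?c)"
    by (rule homotopic_loops_continuous_image) (auto simp: continuous_on_cocycle_map cocycle_map_nonzero)
  then have "winding ?l = winding ?c" by (rule winding_number_homotopic_loops)
  also have "\<dots> = 0"
    by (rule winding_number_constI[of "cocycle_map (pathstart p)"]) (auto simp: cocycle_map_nonzero)
  finally have "winding p + winding (reversepath q) = 0"
    using winding_join[OF p r] ends by simp
  moreover have "winding (reversepath q) = - winding q"
    unfolding path_compose_reversepath by (intro winding_number_reversepath path_cocycle_map q)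
  ultimately show ?thesis by simp
qed

text \<open>The potential at a vertex is the winding number along any path to it from a root;
  \<open>winding_unique\<close> makes it independent of the path, so appending an edge adds the
  value of \<theta>.\<close>

theorem flag_cocycle_is_coboundary:
  assumes con: "Digraph_Component.connected G" and S: "simply_connected (realization (flag_complex G))"
  obtains \<eta> :: "'a \<Rightarrow> real" where "\<And>u v. u \<rightarrow>\<^bsub>G\<^esub> v \<Longrightarrow> \<eta> v = \<eta> u + of_int (\<theta> u v)"
proof -
  let ?S = "realization (flag_complex G)"
  interpret graph G by (rule G)
  obtain r where r: "r \<in> verts G"
    using con connected_iff_closed_sets by blast
  define P where "P v p \<longleftrightarrow> path p \<and> path_image p \<subseteq> ?S \<and> pathstart p = simplex_coords r
      \<and> pathfinish p = simplex_coords v" for v p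
  have step: "P v (p +++ edge_path u v)" if "P u p" "u \<rightarrow>\<^bsub>G\<^esub> v" for u v p
    using that path_image_edge_path[OF that(2)] path_edge_path[of u v]
    unfolding P_def by (intro conjI path_join_imp subset_path_image_join) auto
  have "P r (\<lambda>_. simplex_coords r)"
  proof -
    have "{w. simplex_coords r w \<noteq> 0} = {r}" by (auto simp: simplex_coords_def)
    then have "simplex_coords r \<in> ?S"
      using r unfolding realization_def mem_Collect_eq
      by (simp only:) (simp add: simplex_coords_def flag_complex_def)
    then show ?thesis
      by (auto simp: P_def path_def path_image_def pathstart_def pathfinish_def)
  qed
  then have r': "\<exists>p. P r p" by blast
  have "\<exists>p. P v p" if "v \<in> verts G" for v
    by (rule connected_closed_set[where P="\<lambda>v. \<exists>p. P v p", OF G con r r' _ that])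
      (use step in blast)
  then obtain p where p: "\<And>v. v \<in> verts G \<Longrightarrow> P v (p v)" by metis
  show ?thesis
  proof (rule that)
    fix u v assume e: "u \<rightarrow>\<^bsub>G\<^esub> v"
    then have uv: "u \<in> verts G" "v \<in> verts G" by (auto dest: adj_in_verts)
    have "winding (p v) = winding (p u +++ edge_path u v)"
      using p[OF uv(2)] step[OF p[OF uv(1)] e] unfolding P_def by (intro winding_unique[OF S]) auto
    also have "\<dots> = winding (p u) + winding (edge_path u v)"
      using p[OF uv(1)] path_image_edge_path[OF e] path_edge_path[of u v] unfolding P_def
      by (intro winding_join) auto
    \<comment> \<open>Winding numbers of open paths are complex in general. Real parts suffice, as
      every edge contributes an integer.\<close>
    finally show "Re (winding (p v)) = Re (winding (p u)) + of_int (\<theta> u v)"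
      using winding_edge_path[OF e] by simp
  qed
qed

end

section \<open>Potentials collinear on triangles\<close>

text \<open>Two plane vectors parallel to the same nonzero vector \<open>(a1, a2)\<close> are
  parallel to each other.\<close>

lemma proportional_trans:
  fixes a1 a2 b1 b2 c1 c2 :: real
  assumes "a1 \<noteq> 0 \<or> a2 \<noteq> 0" "a1 * b2 = b1 * a2" "a1 * c2 = c1 * a2"
  shows "b1 * c2 = c1 * b2"
proof (cases "a1 = 0")
  case False
  have "a1 * (b1 * c2) = b1 * (a1 * c2)" by simp
  also have "\<dots> = c1 * (b1 * a2)" by (simp add: assms(3))
  also have "\<dots> = a1 * (c1 * b2)" by (simp flip: assms(2))
  finally show ?thesis using False by simp
next
  case True
  then show ?thesis using assms by simp
qed

lemma biconnected_connected: "biconnected G \<Longrightarrow> Digraph_Component.connected G"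
  by (simp add: biconnected_def)

context
  fixes G :: "('a, 'b) pre_digraph" and F K :: "'a \<Rightarrow> real"
  assumes G: "graph G"
    and triangle: "\<And>u v w. u \<rightarrow>\<^bsub>G\<^esub> v \<Longrightarrow> v \<rightarrow>\<^bsub>G\<^esub> w \<Longrightarrow> u \<rightarrow>\<^bsub>G\<^esub> w \<Longrightarrow>
      (F u - F v) * (K v - K w) = (F v - F w) * (K u - K v)"
begin

text \<open>\<open>(F, K)\<close> is viewed as a map of the vertices to the plane; the assumption
  \<open>triangle\<close> says that corners of triangles become collinear. Null edges are those
  collapsed to a point.\<close>

definition null_edge :: "'a \<Rightarrow> 'a \<Rightarrow> bool" where
  "null_edge u v \<longleftrightarrow> u \<rightarrow>\<^bsub>G\<^esub> v \<and> F u = F v \<and> K u = K v"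

definition null_component :: "'a \<Rightarrow> 'a set" where
  "null_component u = {v. null_edge\<^sup>*\<^sup>* u v}"

text \<open>The vanishing determinant of two edge vectors in the plane; a collapsed edge is parallel
  to every edge.\<close>

definition parallel :: "'a \<Rightarrow> 'a \<Rightarrow> 'a \<Rightarrow> 'a \<Rightarrow> bool" where
  "parallel u v x y \<longleftrightarrow> (F u - F v) * (K x - K y) = (F x - F y) * (K u - K v)"

lemma null_component_self: "u \<in> null_component u"
  by (simp add: null_component_def)

lemma null_component_constant:
  assumes "v \<in> null_component u" shows "F v = F u \<and> K v = K u"
proof -
  have "null_edge\<^sup>*\<^sup>* u v" using assms by (simp add: null_component_def)
  then show ?thesis by induction (auto simp: null_edge_def)
qed

lemma null_component_verts:
  assumes "u \<in> verts G" shows "null_component u \<subseteq> verts G"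
proof
  fix v assume "v \<in> null_component u"
  then have "null_edge\<^sup>*\<^sup>* u v" by (simp add: null_component_def)
  then show "v \<in> verts G"
    by induction (use assms graph_dominates_verts[OF G] in \<open>auto simp: null_edge_def\<close>)
qed

lemma null_component_step:
  assumes "v \<in> null_component u" "v \<rightarrow>\<^bsub>G\<^esub> w" "F v = F w" "K v = K w"
  shows "w \<in> null_component u"
  using assms unfolding null_component_def
  by (auto simp: null_edge_def intro: rtranclp.rtrancl_into_rtrancl)

lemma null_component_eq:
  assumes "v \<in> null_component u" shows "null_component v = null_component u"
proof -
  have "symp null_edge"
    using graph_dominates_sym[OF G] by (auto simp: symp_def null_edge_def)
  then have s: "symp null_edge\<^sup>*\<^sup>*" by (rule symp_rtranclp)
  have "null_edge\<^sup>*\<^sup>* u v" using assms by (simp add: null_component_def)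
  then show ?thesis
    unfolding null_component_def using sympD[OF s] by (auto intro: rtranclp_trans)
qed

lemma null_component_leaving:
  assumes "s \<in> null_component u" "t \<notin> null_component u" "s \<rightarrow>\<^bsub>G\<^esub> t"
  shows "F s - F t \<noteq> 0 \<or> K s - K t \<noteq> 0"
  using null_component_step[OF assms(1,3)] assms(2) by auto

lemma parallel_commute: "parallel s t x y \<longleftrightarrow> parallel t s x y"
  unfolding parallel_def by (auto simp: algebra_simps)

text \<open>The image of the triangle lies on a line, and the edge \<open>s t\<close> is not
  collapsed since it leaves the component, so it determines the direction of that line.\<close>

lemma parallel_leaving:
  assumes s: "s \<in> null_component u" and t: "t \<notin> null_component u" and w: "w \<notin> null_component u"
    and e: "s \<rightarrow>\<^bsub>G\<^esub> t" "s \<rightarrow>\<^bsub>G\<^esub> w" "t \<rightarrow>\<^bsub>G\<^esub> w" and p: "parallel s t x y"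
  shows "parallel s w x y"
proof -
  have "(F t - F s) * (K s - K w) = (F s - F w) * (K t - K s)"
    by (rule triangle[OF graph_dominates_sym[OF G e(1)] e(2,3)])
  then have "(F s - F t) * (K s - K w) = (F s - F w) * (K s - K t)"
    by (simp add: algebra_simps)
  then show ?thesis
    using p null_component_leaving[OF s t e(1)] proportional_trans[of "F s - F t" "K s - K t"]
    unfolding parallel_def by blast
qed

text \<open>
  The indicator of the edges leaving the component in the direction of the edge \<open>x y\<close> is a cocycle.
  Its potential is constant on the component and locally constant off it, but jumps by one along
  \<open>x y\<close> and not at all along \<open>x' y'\<close>.
\<close>

lemma null_component_separating:
  assumes con: "Digraph_Component.connected G"
    and sc: "simply_connected (realization (flag_complex G))" and u: "u \<in> verts G"
    and x: "x \<in> null_component u" "x \<rightarrow>\<^bsub>G\<^esub> y" "y \<notin> null_component u"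
    and x': "x' \<in> null_component u" "x' \<rightarrow>\<^bsub>G\<^esub> y'" "y' \<notin> null_component u"
    and np: "\<not> parallel x' y' x y"
  shows "disconnected (G \<restriction> (verts G - null_component u))"
proof -
  let ?D = "null_component u"
  define \<theta> :: "'a \<Rightarrow> 'a \<Rightarrow> int" where
    "\<theta> s t = (if s \<in> ?D \<and> t \<notin> ?D \<and> parallel s t x y then 1 else 0)
      - (if t \<in> ?D \<and> s \<notin> ?D \<and> parallel s t x y then 1 else 0)" for s t
  have same: "parallel s w x y \<longleftrightarrow> parallel t w x y" if "s \<in> ?D" "t \<in> ?D" for s t w
    using null_component_constant[OF that(1)] null_component_constant[OF that(2)]
    by (simp add: parallel_def)
  \<comment> \<open>Count the vertices in \<open>?D\<close>. With none or all inside, every term is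
    0; with one inside, \<open>leave\<close> equates the two leaving edges; with two inside,
    \<open>same\<close> does so and the inner edge contributes 0. Repeated vertices are covered as
    well.\<close>
  have cocycle: "\<theta> s t + \<theta> t w = \<theta> s w" if f: "{s, t, w} \<in> flag_complex G" for s t w
  proof -
    have adj: "a \<rightarrow>\<^bsub>G\<^esub> b" if "a \<in> {s, t, w}" "b \<in> {s, t, w}" "a \<noteq> b" for a b
      using f that by (auto simp: flag_complex_def)
    have leave: "parallel a b x y \<longleftrightarrow> parallel a c x y"
      if "a \<in> {s, t, w}" "b \<in> {s, t, w}" "c \<in> {s, t, w}" "a \<in> ?D" "b \<notin> ?D" "c \<notin> ?D" for a b c
    proof (cases "b = c")
      case False
      have "a \<noteq> b" "a \<noteq> c" using that by auto
      then have "a \<rightarrow>\<^bsub>G\<^esub> b" "a \<rightarrow>\<^bsub>G\<^esub> c" "b \<rightarrow>\<^bsub>G\<^esub> c" "c \<rightarrow>\<^bsub>G\<^esub> b"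
        using adj that(1-3) False by auto
      then show ?thesis using parallel_leaving that(4-6) by blast
    qed simp
    have c: "parallel t s x y \<longleftrightarrow> parallel s t x y" "parallel w s x y \<longleftrightarrow> parallel s w x y"
      "parallel w t x y \<longleftrightarrow> parallel t w x y"
      by (rule parallel_commute)+
    show ?thesis
      unfolding \<theta>_def
      using leave[of s t w] leave[of t s w] leave[of w s t] same[of s t w] same[of s w t] same[of t w s]
      unfolding c by (smt (verit) insertCI)
  qed
  obtain \<eta> :: "'a \<Rightarrow> real" where \<eta>: "\<And>s t. s \<rightarrow>\<^bsub>G\<^esub> t \<Longrightarrow> \<eta> t = \<eta> s + of_int (\<theta> s t)"
    using flag_cocycle_is_coboundary[of G \<theta>, OF G cocycle con sc] by blast
  have const: "\<eta> v = \<eta> u" if "v \<in> ?D" for v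
  proof -
    have "null_edge\<^sup>*\<^sup>* u v" using that by (simp add: null_component_def)
    then show ?thesis
    proof induction
      case (step s t)
      have "s \<in> ?D" "t \<in> ?D" using step(1,2) by (auto simp: null_component_def)
      then have "\<theta> s t = 0" by (simp add: \<theta>_def)
      then show ?case using \<eta>[of s t] step(2,3) by (simp add: null_edge_def)
    qed simp
  qed
  have y: "y \<in> verts G" "y' \<in> verts G" using graph_dominates_verts[OF G] x(2) x'(2) by auto
  have \<eta>y: "\<eta> y = \<eta> u + 1"
    using \<eta>[OF x(2)] const[OF x(1)] x by (simp add: \<theta>_def parallel_def)
  have \<eta>y': "\<eta> y' = \<eta> u"
    using \<eta>[OF x'(2)] const[OF x'(1)] x' np by (simp add: \<theta>_def)
  \<comment> \<open>Off \<open>?D\<close> the potential is locally constant, so its level sets there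
    are closed under adjacency. This level contains \<open>y\<close> and misses
    \<open>y'\<close>.\<close>
  let ?A = "{v \<in> verts G - ?D. \<eta> v = \<eta> u + 1}"
  have closed: "t \<in> ?A" if "s \<in> ?A" "t \<in> verts G - ?D" "s \<rightarrow>\<^bsub>G\<^esub> t" for s t
    using \<eta>[OF that(3)] that(1,2) by (simp add: \<theta>_def)
  have "y \<in> ?A" "y' \<notin> ?A" "y' \<in> verts G - ?D"
    using y x(3) x'(3) \<eta>y \<eta>y' by auto
  then have "?A \<noteq> {}" "?A \<noteq> verts G - ?D" by blast+
  then show ?thesis
    using closed by (subst disconnected_induce_iff[OF G]) (blast, intro exI[of _ ?A], blast)
qed

text \<open>If the edges leaving each null component were all parallel, one direction would spread
  through the connected graph and \<open>(F, K)\<close> would map into a line, against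
  \<open>indep\<close>. So some component has two leaving directions and separates. A single vertex
  would be a cut vertex; hence each vertex of the component lies on a null edge, and null edges lie
  inside \<open>L\<close> by \<open>living\<close>. Minimality of \<open>L\<close> gives
  equality.\<close>

theorem potential_constant_on_separator:
  assumes bi: "biconnected G" and sc: "simply_connected (realization (flag_complex G))"
    and L: "minimal_full_separating G L"
    and living: "\<And>u v. u \<rightarrow>\<^bsub>G\<^esub> v \<Longrightarrow> \<not> (u \<in> verts L \<and> v \<in> verts L) \<Longrightarrow> F u \<noteq> F v"
    and indep: "\<And>p q. (\<And>u v. u \<rightarrow>\<^bsub>G\<^esub> v \<Longrightarrow> p * (F u - F v) + q * (K u - K v) = 0) \<Longrightarrow> p = 0 \<and> q = 0"
    and uv: "u \<in> verts L" "v \<in> verts L"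
  shows "F u = F v"
proof -
  have con: "Digraph_Component.connected G" using bi by (rule biconnected_connected)
  have "\<exists>u\<in>verts G. \<exists>x\<in>null_component u. \<exists>x'\<in>null_component u. \<exists>y y'. x \<rightarrow>\<^bsub>G\<^esub> y \<and> y \<notin> null_component u
      \<and> x' \<rightarrow>\<^bsub>G\<^esub> y' \<and> y' \<notin> null_component u \<and> \<not> parallel x' y' x y"
  proof (rule ccontr)
    assume "\<not> ?thesis"
    then have all: "parallel x' y' x y" if "u \<in> verts G" "x \<in> null_component u" "x' \<in> null_component u"
      "x \<rightarrow>\<^bsub>G\<^esub> y" "y \<notin> null_component u" "x' \<rightarrow>\<^bsub>G\<^esub> y'" "y' \<notin> null_component u" for u x x' y y'
      using that by blast
    obtain x0 y0 where e0: "x0 \<rightarrow>\<^bsub>G\<^esub> y0" and n0: "F x0 - F y0 \<noteq> 0 \<or> K x0 - K y0 \<noteq> 0"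
      using indep[of 1 1] indep[of 1 0] by fastforce
    have x0: "x0 \<in> verts G" using graph_dominates_verts[OF G e0] by simp
    define P where "P u \<longleftrightarrow> (\<forall>s\<in>null_component u. \<forall>t. s \<rightarrow>\<^bsub>G\<^esub> t \<longrightarrow> t \<notin> null_component u \<longrightarrow>
      parallel s t x0 y0)" for u
    have "y0 \<notin> null_component x0"
      using null_component_constant n0 by auto
    then have P0: "P x0"
      unfolding P_def using all[OF x0 null_component_self _ e0] by blast
    \<comment> \<open>An edge leaving the component of \<open>s\<close> also leaves that of
      \<open>t\<close> when reversed, so it carries the direction from one to the other.\<close>
    have step: "P t" if e: "s \<rightarrow>\<^bsub>G\<^esub> t" and Ps: "P s" for s t
    proof (cases "t \<in> null_component s")
      case True
      then show ?thesis using Ps null_component_eq[OF True] by (simp add: P_def)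
    next
      case False
      have t: "t \<in> verts G" using graph_dominates_verts[OF G e] by simp
      have "s \<notin> null_component t"
        using null_component_eq[of s t] null_component_self[of t] False by blast
      then have "parallel a b t s" if "a \<in> null_component t" "a \<rightarrow>\<^bsub>G\<^esub> b" "b \<notin> null_component t" for a b
        using all[OF t null_component_self that(1) graph_dominates_sym[OF G e]] that by blast
      moreover have "parallel s t x0 y0"
        using Ps e False null_component_self by (auto simp: P_def)
      then have ts: "parallel t s x0 y0" by (simp add: parallel_commute)
      have nz: "F t - F s \<noteq> 0 \<or> K t - K s \<noteq> 0"
        using null_component_leaving[OF null_component_self False e] by auto
      have "parallel a b x0 y0" if "parallel a b t s" for a b
        using proportional_trans[OF nz that[unfolded parallel_def, symmetric] ts[unfolded parallel_def]]
        unfolding parallel_def .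
      ultimately show ?thesis unfolding P_def by blast
    qed
    have all0: "parallel s t x0 y0" if e: "s \<rightarrow>\<^bsub>G\<^esub> t" for s t
    proof (cases "t \<in> null_component s")
      case True
      then show ?thesis using null_component_constant[OF True] by (simp add: parallel_def)
    next
      case False
      have "s \<in> verts G" using graph_dominates_verts[OF G e] by simp
      then have "P s" using connected_closed_set[OF G con x0, of P s] P0 step by blast
      then show ?thesis using False e null_component_self by (auto simp: P_def)
    qed
    \<comment> \<open>The coefficients form a normal vector to the common direction.\<close>
    have "K x0 - K y0 = 0 \<and> - (F x0 - F y0) = 0"
    proof (rule indep)
      fix s t assume "s \<rightarrow>\<^bsub>G\<^esub> t"
      from all0[OF this] show "(K x0 - K y0) * (F s - F t) + - (F x0 - F y0) * (K s - K t) = 0"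
        by (simp add: parallel_def algebra_simps)
    qed
    then show False using n0 by simp
  qed
  then obtain r where r: "r \<in> verts G" and sep: "disconnected (G \<restriction> (verts G - null_component r))"
    using null_component_separating[OF con sc] by blast
  let ?D = "null_component r"
  have DV: "?D \<subseteq> verts G" using r by (rule null_component_verts)
  have null_L: "s \<in> verts L \<and> t \<in> verts L" if "null_edge s t" for s t
    using living[of s t] that by (auto simp: null_edge_def)
  have "?D \<noteq> {r}"
    using sep r bi by (auto simp: biconnected_def cut_vertex_def)
  then obtain z where z: "z \<in> ?D" "z \<noteq> r" using null_component_self by blast
  have DL: "?D \<subseteq> verts L"
  proof
    fix s assume "s \<in> ?D"
    then have s: "null_edge\<^sup>*\<^sup>* r s" by (simp add: null_component_def)
    show "s \<in> verts L"
    proof (cases "s = r")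
      case True
      have "null_edge\<^sup>*\<^sup>* r z" using z by (simp add: null_component_def)
      then obtain t where "null_edge r t" using z(2) by (auto elim: converse_rtranclpE)
      then show ?thesis using True null_L by blast
    next
      case False
      then obtain t where "null_edge t s" using s by (auto elim: rtranclp.cases)
      then show ?thesis using null_L by blast
    qed
  qed
  have LG: "induced_subgraph L G" "wf_digraph L"
    using L by (auto simp: minimal_full_separating_def induced_subgraph_def subgraph_def)
  have wf: "wf_digraph G" using LG by (simp add: induced_subgraph_def subgraph_def)
  have "G \<restriction> ?D = L"
  proof (rule ccontr)
    assume ne: "G \<restriction> ?D \<noteq> L"
    have subG: "subgraph (G \<restriction> ?D) G"
      by (rule wf_digraph.subgraph_induce_subgraphI[OF wf DV])
    have "induced_subgraph (G \<restriction> ?D) L"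
      using LG DL subG
      by (auto simp: induced_subgraph_def subgraph_def compatible_def)
    moreover have "separating G (G \<restriction> ?D)"
      using sep subG by (simp add: separating_def)
    ultimately show False
      using L ne unfolding minimal_full_separating_def by blast
  qed
  then have "verts L = ?D" by auto
  then show ?thesis
    using uv null_component_constant by metis
qed

end

section \<open>Resonance\<close>

text \<open>The real Heisenberg group, written additively: \<open>Heis a b c\<close> is the upper
  unitriangular matrix with \<open>a\<close>, \<open>b\<close> above the diagonal and
  \<open>c\<close> in the corner.\<close>

datatype heis = Heis (heis_x: real) (heis_y: real) (heis_z: real)

instantiation heis :: group_add
begin

definition "0 = Heis 0 0 0"

fun plus_heis :: "heis \<Rightarrow> heis \<Rightarrow> heis" where
  "Heis a b c + Heis a' b' c' = Heis (a + a') (b + b') (c + c' + a * b')"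

fun uminus_heis :: "heis \<Rightarrow> heis" where
  "- Heis a b c = Heis (- a) (- b) (a * b - c)"

definition "(g :: heis) - h = g + - h"

instance
proof
  fix f g h :: heis
  show "f + g + h = f + (g + h)" by (cases f; cases g; cases h) (simp add: algebra_simps)
  show "0 + f = f" "f + 0 = f" "- f + f = 0" by (cases f; simp add: zero_heis_def)+
  show "f + - g = f - g" by (simp add: minus_heis_def)
qed

end

lemma heis_sel_plus [simp]:
  "heis_x (g + h) = heis_x g + heis_x h"
  "heis_y (g + h) = heis_y g + heis_y h"
  "heis_z (g + h) = heis_z g + heis_z h + heis_x g * heis_y h"
  by (cases g; cases h; simp)+

text \<open>The class \<open>group_add\<close> does not presuppose commutativity, so real and
  Heisenberg-valued homomorphisms share one theory.\<close>

definition word_value :: "('a \<Rightarrow> 'g::group_add) \<Rightarrow> 'a word \<Rightarrow> 'g" where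
  "word_value f w = sum_list (map (\<lambda>(x, b). if b then f x else - f x) w)"

lemma word_value_simps [simp]:
  "word_value f [] = 0"
  "word_value f ((x, b) # w) = (if b then f x else - f x) + word_value f w"
  "word_value f (u @ v) = word_value f u + word_value f v"
  by (auto simp: word_value_def)

lemma word_value_pres_cong:
  assumes "(u, v) \<in> pres_cong X R"
    and "\<And>r s. (r, s) \<in> R \<Longrightarrow> word_value f r = word_value f s"
  shows "word_value f u = word_value f v"
  using assms(1) by induction (auto simp: assms(2) simp flip: add.assoc)

section \<open>Homomorphisms from presented groups to additive groups\<close>

definition additive_on :: "('g, 'x) monoid_scheme \<Rightarrow> ('g \<Rightarrow> 'h::group_add) \<Rightarrow> bool" where
  "additive_on G h \<longleftrightarrow> (\<forall>x\<in>carrier G. \<forall>y\<in>carrier G. h (x \<otimes>\<^bsub>G\<^esub> y) = h x + h y)"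

lemma additiveD:
  "additive_on G h \<Longrightarrow> x \<in> carrier G \<Longrightarrow> y \<in> carrier G \<Longrightarrow> h (x \<otimes>\<^bsub>G\<^esub> y) = h x + h y"
  by (simp add: additive_on_def)

lemma additive_cong:
  assumes "group G" "additive_on G h" "\<And>x. x \<in> carrier G \<Longrightarrow> h x = k x" shows "additive_on G k"
proof -
  interpret group G by fact
  show ?thesis
    unfolding additive_on_def
  proof (intro ballI)
    fix x y assume xy: "x \<in> carrier G" "y \<in> carrier G"
    show "k (x \<otimes>\<^bsub>G\<^esub> y) = k x + k y"
      using additiveD[OF assms(2) xy] assms(3)[of x] assms(3)[of y] assms(3)[of "x \<otimes>\<^bsub>G\<^esub> y"] xy
      by simp
  qed
qed

lemma carrier_presented_group:
  "carrier (presented_group X R) = (\<lambda>w. pres_cong X R `` {w}) ` words X"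
  by (auto simp: presented_group_def quotient_def)

text \<open>Von Dyck's theorem. The values on a class form a singleton, which justifies
  \<open>the_elem\<close>.\<close>

lemma presented_group_universal:
  assumes "\<And>r s. (r, s) \<in> R \<Longrightarrow> word_value f r = word_value f s"
  obtains h where "additive_on (presented_group X R) h"
    and "\<And>w. w \<in> words X \<Longrightarrow> h (pres_cong X R `` {w}) = word_value f w"
proof -
  let ?h = "\<lambda>A. the_elem (word_value f ` A)"
  have h: "?h (pres_cong X R `` {w}) = word_value f w" if "w \<in> words X" for w
  proof -
    have "word_value f ` (pres_cong X R `` {w}) = {word_value f w}"
      using that word_value_pres_cong[of _ _ X R f, OF _ assms] by (fastforce intro: pres_cong.refl)
    then show ?thesis by simp
  qed
  show ?thesis
    by (rule that[of ?h]) (auto simp: h additive_on_def carrier_presented_group presented_group_mult)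
qed

lemma additive_presented_group:
  assumes h: "additive_on (presented_group X R) h" and "w \<in> words X"
  shows "h (pres_cong X R `` {w}) = word_value (\<lambda>x. h (pres_cong X R `` {[(x, True)]})) w"
proof -
  let ?c = "\<lambda>w. pres_cong X R `` {w}"
  have mult: "h (?c (u @ v)) = h (?c u) + h (?c v)" if "u \<in> words X" "v \<in> words X" for u v
    using additiveD[OF h, of "?c u" "?c v"] presented_group_mult[OF that, of R] that
    by (simp add: carrier_presented_group)
  have "h (?c []) + h (?c []) = h (?c []) + 0" using mult[of "[]" "[]"] by simp
  then have nil: "h (?c []) = 0" by (simp only: add_left_cancel)
  show ?thesis
    using assms(2)
  proof (induction w)
    case Nil
    then show ?case using nil by simp
  next
    case (Cons p w)
    obtain x b where p: "p = (x, b)" by (cases p)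
    have x: "x \<in> X" "w \<in> words X" using Cons.prems p by auto
    have "h (?c [(x, b)]) = (if b then h (?c [(x, True)]) else - h (?c [(x, True)]))"
    proof (cases b)
      case False
      have "([(x, False), (x, True)], []) \<in> pres_cong X R"
        using pres_cong.cancel[of "[]" X "[]" x False R] x by simp
      then have "?c [(x, False), (x, True)] = ?c []" by (rule equiv_class_eq[OF equiv_pres_cong])
      then have "h (?c [(x, False)]) + h (?c [(x, True)]) = 0"
        using mult[of "[(x, False)]" "[(x, True)]"] x nil by simp
      then show ?thesis using False by (simp add: eq_neg_iff_add_eq_0)
    qed simp
    then show ?case using mult[of "[(x, b)]" w] Cons.IH x p by simp
  qed
qed

lemma additive_heis:
  fixes h :: "'g \<Rightarrow> heis"
  assumes "additive_on G h"
  shows "additive_on G (heis_x \<circ> h)" "additive_on G (heis_y \<circ> h)"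
  using assms by (auto simp: additive_on_def)

lemma additive_linear:
  fixes a b :: "'g \<Rightarrow> real"
  assumes "additive_on G a" "additive_on G b"
  shows "additive_on G (\<lambda>x. s * a x + t * b x)" "additive_on G (\<lambda>x. a x - b x)"
  using assms by (auto simp: additive_on_def algebra_simps)

text \<open>
  A homomorphism to the Heisenberg group lifting the pair \<open>(a, b)\<close> exists iff the cup product of
  the classes \<open>a\<close> and \<open>b\<close> vanishes, so the resonant homomorphisms form the first resonance
  variety of the group.
\<close>

definition independent_homs :: "('g, 'x) monoid_scheme \<Rightarrow> ('g \<Rightarrow> real) \<Rightarrow> ('g \<Rightarrow> real) \<Rightarrow> bool" where
  "independent_homs G a b \<longleftrightarrow>
     (\<forall>s t. (\<forall>x\<in>carrier G. s * a x + t * b x = 0) \<longrightarrow> s = 0 \<and> t = 0)"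

definition resonant :: "('g, 'x) monoid_scheme \<Rightarrow> ('g \<Rightarrow> real) \<Rightarrow> bool" where
  "resonant G a \<longleftrightarrow>
     (\<exists>h :: 'g \<Rightarrow> heis. additive_on G h \<and> (\<forall>x\<in>carrier G. heis_x (h x) = a x) \<and>
        independent_homs G a (heis_y \<circ> h))"

text \<open>An isomorphism-invariant form of "resonance is a union of coordinate subspaces". Values
  on \<open>E\<close> act as coordinates: the first clause switches off those where
  \<open>a'\<close> vanishes, the second lets resonance pass to any nonzero homomorphism with
  smaller support.\<close>

definition coordinate_resonance :: "('g, 'x) monoid_scheme \<Rightarrow> bool" where
  "coordinate_resonance G \<longleftrightarrow> (\<exists>E. finite E \<and> E \<subseteq> carrier G \<and>
     (\<forall>a a'. additive_on G a \<longrightarrow> additive_on G a' \<longrightarrow>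
        (\<exists>b :: 'g \<Rightarrow> real. additive_on G b \<and> (\<forall>e\<in>E. b e = (if a' e = (0::real) then 0 else a e)))) \<and>
     (\<forall>a a'. resonant G a \<longrightarrow> additive_on G a' \<longrightarrow> (\<exists>x\<in>carrier G. a' x \<noteq> 0) \<longrightarrow>
        (\<forall>e\<in>E. a' e \<noteq> 0 \<longrightarrow> a e \<noteq> 0) \<longrightarrow> resonant G a'))"

section \<open>Invariance of resonance under isomorphism\<close>

lemma additive_compose:
  assumes "\<phi> \<in> hom G H" "additive_on H a" shows "additive_on G (a \<circ> \<phi>)"
  using assms by (auto simp: additive_on_def hom_def Pi_def)

lemma resonant_compose:
  assumes \<phi>: "\<phi> \<in> iso G H" and "resonant H a"
  shows "resonant G (a \<circ> \<phi>)"
proof -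
  obtain h where h: "additive_on H h" "\<forall>x\<in>carrier H. heis_x (h x) = a x"
      "independent_homs H a (heis_y \<circ> h)"
    using assms(2) by (auto simp: resonant_def)
  have im: "\<phi> ` carrier G = carrier H" using \<phi> by (auto simp: iso_def bij_betw_def)
  show ?thesis
    unfolding resonant_def
  proof (intro exI[of _ "h \<circ> \<phi>"] conjI)
    show "additive_on G (h \<circ> \<phi>)" using \<phi> h(1) by (auto simp: iso_def intro: additive_compose)
    show "independent_homs G (a \<circ> \<phi>) (heis_y \<circ> (h \<circ> \<phi>))"
      unfolding independent_homs_def
    proof (intro allI impI)
      fix s t assume st: "\<forall>x\<in>carrier G. s * (a \<circ> \<phi>) x + t * (heis_y \<circ> (h \<circ> \<phi>)) x = 0"
      have "s * a y + t * (heis_y \<circ> h) y = 0" if y: "y \<in> carrier H" for y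
      proof -
        from y im obtain x where "x \<in> carrier G" "y = \<phi> x" by blast
        with st show ?thesis by simp
      qed
      with h(3) show "s = 0 \<and> t = 0" unfolding independent_homs_def by blast
    qed
  qed (use h(2) im in auto)
qed

lemma resonant_cong:
  assumes "resonant G a" "\<And>x. x \<in> carrier G \<Longrightarrow> a x = b x" shows "resonant G b"
  using assms by (fastforce simp: resonant_def independent_homs_def)

lemma coordinate_resonance_iso:
  assumes "group G" "G \<cong> H" "coordinate_resonance H"
  shows "coordinate_resonance G"
proof -
  obtain \<phi> where \<phi>: "\<phi> \<in> iso G H" using assms(2) by (auto simp: is_iso_def)
  define \<psi> where "\<psi> = inv_into (carrier G) \<phi>"
  have \<psi>: "\<psi> \<in> iso H G" unfolding \<psi>_def using assms(1) \<phi> by (rule group.iso_set_sym)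
  have bij: "bij_betw \<phi> (carrier G) (carrier H)" using \<phi> by (auto simp: iso_def)
  have inv: "\<phi> (\<psi> y) = y" if "y \<in> carrier H" for y
    using that bij unfolding \<psi>_def by (auto simp: bij_betw_def f_inv_into_f)
  have inv': "\<psi> (\<phi> x) = x" if "x \<in> carrier G" for x
    using that bij unfolding \<psi>_def by (auto simp: bij_betw_def)
  have \<psi>_mem: "\<psi> y \<in> carrier G" if "y \<in> carrier H" for y
    using that \<psi> by (auto simp: iso_def hom_def)
  have \<phi>_mem: "\<phi> x \<in> carrier H" if "x \<in> carrier G" for x
    using that \<phi> by (auto simp: iso_def hom_def)
  have hom: "\<phi> \<in> hom G H" "\<psi> \<in> hom H G" using \<phi> \<psi> by (auto simp: iso_def)
  obtain E where E: "finite E" "E \<subseteq> carrier H"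
    and restrict: "\<forall>a a'. additive_on H a \<longrightarrow> additive_on H a' \<longrightarrow>
        (\<exists>b :: _ \<Rightarrow> real. additive_on H b \<and> (\<forall>e\<in>E. b e = (if a' e = (0::real) then 0 else a e)))"
    and mono: "\<forall>a a'. resonant H a \<longrightarrow> additive_on H a' \<longrightarrow> (\<exists>x\<in>carrier H. a' x \<noteq> 0) \<longrightarrow>
        (\<forall>e\<in>E. a' e \<noteq> 0 \<longrightarrow> a e \<noteq> 0) \<longrightarrow> resonant H a'"
    using assms(3) unfolding coordinate_resonance_def by - (elim exE conjE, rule that)
  show ?thesis
    unfolding coordinate_resonance_def
  proof (intro exI[of _ "\<psi> ` E"] conjI allI impI)
    fix a a' :: "_ \<Rightarrow> real" assume "additive_on G a" "additive_on G a'"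
    then have "additive_on H (a \<circ> \<psi>)" "additive_on H (a' \<circ> \<psi>)" using hom additive_compose by blast+
    from restrict[rule_format, OF this] obtain b where b: "additive_on H b"
      "\<forall>e\<in>E. b e = (if (a' \<circ> \<psi>) e = 0 then 0 else (a \<circ> \<psi>) e)" by blast
    have "additive_on G (b \<circ> \<phi>)" using b(1) hom additive_compose by blast
    moreover have "\<forall>e\<in>\<psi> ` E. (b \<circ> \<phi>) e = (if a' e = 0 then 0 else a e)"
      using b(2) inv E(2) by auto
    ultimately show "\<exists>b. additive_on G b \<and> (\<forall>e\<in>\<psi> ` E. b e = (if a' e = 0 then 0 else a e))" by blast
  next
    fix a a' :: "_ \<Rightarrow> real"
    assume a: "resonant G a" "additive_on G a'" "\<exists>x\<in>carrier G. a' x \<noteq> 0"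
      "\<forall>e\<in>\<psi> ` E. a' e \<noteq> 0 \<longrightarrow> a e \<noteq> 0"
    have "resonant H (a' \<circ> \<psi>)"
    proof (rule mono[rule_format])
      show "resonant H (a \<circ> \<psi>)" using \<psi> a(1) by (rule resonant_compose)
      show "additive_on H (a' \<circ> \<psi>)" using hom(2) a(2) by (rule additive_compose)
      obtain x where "x \<in> carrier G" "a' x \<noteq> 0" using a(3) by blast
      then show "\<exists>x\<in>carrier H. (a' \<circ> \<psi>) x \<noteq> 0"
        using \<phi>_mem inv' by (intro bexI[of _ "\<phi> x"]) auto
      show "(a \<circ> \<psi>) y \<noteq> 0" if "y \<in> E" "(a' \<circ> \<psi>) y \<noteq> 0" for y
        using a(4) that by simp
    qed
    then have "resonant G (a' \<circ> \<psi> \<circ> \<phi>)" by (rule resonant_compose[OF \<phi>])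
    then show "resonant G a'" by (rule resonant_cong) (simp add: inv')
  qed (use E \<psi>_mem in auto)
qed

section \<open>Artin groups\<close>

lemma word_value_alternating_eq:
  "f a = f b \<Longrightarrow> word_value f (alternating_word a b n) = word_value f (alternating_word b a n)"
  by (induction n arbitrary: a b) auto

lemma word_value_alternating_real:
  fixes f :: "'a \<Rightarrow> real"
  shows "word_value f (alternating_word a b (k * 2)) = real k * (f a + f b)"
  by (induction k) (auto simp: algebra_simps)

text \<open>This is the \<open>k\<close>-th power of the product of the two values; its central
  coordinate picks up \<open>x * y\<close> once for each pair of factors. Exchanging
  \<open>a\<close> and \<open>b\<close> thus affects only the term
  \<open>heis_x (f a) * heis_y (f b)\<close>.\<close>

lemma word_value_alternating_heis:
  fixes f :: "'a \<Rightarrow> heis" and a b :: 'a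
  defines "x \<equiv> heis_x (f a) + heis_x (f b)" and "y \<equiv> heis_y (f a) + heis_y (f b)"
  shows "word_value f (alternating_word a b (k * 2)) = Heis (real k * x) (real k * y)
    (real k * (heis_z (f a) + heis_z (f b) + heis_x (f a) * heis_y (f b)) +
     real k * (real k - 1) / 2 * x * y)"
proof (induction k)
  case 0
  then show ?case by (simp add: zero_heis_def)
next
  case (Suc k)
  have "word_value f (alternating_word a b (Suc k * 2)) =
      f a + (f b + word_value f (alternating_word a b (k * 2)))" by simp
  then show ?case
    unfolding Suc.IH x_def y_def by (cases "f a"; cases "f b") (simp add: field_simps)
qed

lemma alternating_word_in_words: "a \<in> X \<Longrightarrow> b \<in> X \<Longrightarrow> alternating_word a b n \<in> words X"
  by (induction n arbitrary: a b) auto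

abbreviation artin_relations ::
    "('a, 'b) pre_digraph \<Rightarrow> ('a set \<Rightarrow> nat) \<Rightarrow> ('a word \<times> 'a word) set" where
  "artin_relations \<Lambda> m \<equiv>
     {(alternating_word a b (m {a, b}), alternating_word b a (m {a, b})) |a b. a \<rightarrow>\<^bsub>\<Lambda>\<^esub> b}"

context
  fixes \<Lambda> :: "('a, 'b) pre_digraph" and m :: "'a set \<Rightarrow> nat"
  assumes \<Lambda>: "labelled_graph \<Lambda> m"
begin

abbreviation artin_generator :: "'a \<Rightarrow> 'a word set" where
  "artin_generator x \<equiv> pres_cong (verts \<Lambda>) (artin_relations \<Lambda> m) `` {[(x, True)]}"

lemma group_artin_group: "group (artin_group \<Lambda> m)"
  by (simp add: artin_group_def group_presented_group)

lemma artin_edge: "a \<rightarrow>\<^bsub>\<Lambda>\<^esub> b \<Longrightarrow> a \<in> verts \<Lambda> \<and> b \<in> verts \<Lambda> \<and> m {a, b} \<ge> 2"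
  using \<Lambda> unfolding labelled_graph_def
  by (metis fin_digraph.axioms(1) digraph.axioms(1) graph.axioms(1) wf_digraph.adj_in_verts)

lemma artin_generator_carrier: "x \<in> verts \<Lambda> \<Longrightarrow> artin_generator x \<in> carrier (artin_group \<Lambda> m)"
  unfolding artin_group_def carrier_presented_group by auto

lemma artin_additive_relation:
  assumes h: "additive_on (artin_group \<Lambda> m) h" and "a \<rightarrow>\<^bsub>\<Lambda>\<^esub> b"
  shows "word_value (\<lambda>x. h (artin_generator x)) (alternating_word a b (m {a, b})) =
    word_value (\<lambda>x. h (artin_generator x)) (alternating_word b a (m {a, b}))"
proof -
  let ?C = "pres_cong (verts \<Lambda>) (artin_relations \<Lambda> m)"
  let ?u = "alternating_word a b (m {a, b})" and ?v = "alternating_word b a (m {a, b})"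
  have w: "?u \<in> words (verts \<Lambda>)" "?v \<in> words (verts \<Lambda>)"
    using artin_edge[OF assms(2)] by (auto intro: alternating_word_in_words)
  have "(?u, ?v) \<in> ?C"
    using pres_cong.rel[of "[]" "verts \<Lambda>" "[]" ?u ?v "artin_relations \<Lambda> m"] w assms(2) by auto
  then have "?C `` {?u} = ?C `` {?v}" by (rule equiv_class_eq[OF equiv_pres_cong])
  then show ?thesis
    using additive_presented_group[OF h[unfolded artin_group_def] w(1)]
      additive_presented_group[OF h[unfolded artin_group_def] w(2)] by simp
qed

text \<open>With an odd number of letters each side of the relation has one more of its own first
  letter.\<close>

lemma artin_additive_odd:
  fixes h :: "_ \<Rightarrow> real"
  assumes h: "additive_on (artin_group \<Lambda> m) h" and ab: "a \<rightarrow>\<^bsub>\<Lambda>\<^esub> b" "odd (m {a, b})"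
  shows "h (artin_generator a) = h (artin_generator b)"
proof -
  obtain k where "m {a, b} = Suc (k * 2)" using ab(2) by (auto elim!: oddE simp: mult.commute)
  then show ?thesis
    using artin_additive_relation[OF h ab(1)] by (simp add: word_value_alternating_real algebra_simps)
qed

text \<open>For an even label \<open>2 * k\<close> the central coordinates of the two sides differ
  by \<open>k\<close> times the determinant, and \<open>k > 0\<close> since labels are at least 2.
  Along an odd edge both coordinates agree at the ends.\<close>

lemma artin_additive_heis:
  fixes h :: "_ \<Rightarrow> heis"
  assumes h: "additive_on (artin_group \<Lambda> m) h" and ab: "a \<rightarrow>\<^bsub>\<Lambda>\<^esub> b"
  shows "heis_x (h (artin_generator a)) * heis_y (h (artin_generator b)) = heis_x (h (artin_generator b)) * heis_y (h (artin_generator a))"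
proof (cases "even (m {a, b})")
  case True
  then obtain k where k: "m {a, b} = k * 2" by (auto elim!: evenE simp: mult.commute)
  then have "k > 0" using artin_edge[OF ab] by simp
  then show ?thesis
    using artin_additive_relation[OF h ab] unfolding k
    by (simp add: word_value_alternating_heis algebra_simps)
next
  case False
  then show ?thesis
    using artin_additive_odd[OF additive_heis(1)[OF h] ab] artin_additive_odd[OF additive_heis(2)[OF h] ab]
    by simp
qed

text \<open>Central coordinates enter both sides of an even relation symmetrically, so 0 can be
  prescribed; the ends of an odd edge receive the same element.\<close>

lemma artin_heis_hom_exists:
  assumes odd: "\<And>a b. a \<rightarrow>\<^bsub>\<Lambda>\<^esub> b \<Longrightarrow> odd (m {a, b}) \<Longrightarrow> \<alpha> a = \<alpha> b \<and> \<beta> a = \<beta> b"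
    and edge: "\<And>a b. a \<rightarrow>\<^bsub>\<Lambda>\<^esub> b \<Longrightarrow> \<alpha> a * \<beta> b = \<alpha> b * \<beta> a"
  shows "\<exists>h. additive_on (artin_group \<Lambda> m) h \<and> (\<forall>x\<in>verts \<Lambda>. h (artin_generator x) = Heis (\<alpha> x) (\<beta> x) 0)"
proof -
  let ?f = "\<lambda>x. Heis (\<alpha> x) (\<beta> x) 0"
  have rel: "word_value ?f r = word_value ?f s" if rs: "(r, s) \<in> artin_relations \<Lambda> m" for r s
  proof -
    obtain a b where ab: "a \<rightarrow>\<^bsub>\<Lambda>\<^esub> b" and r: "r = alternating_word a b (m {a, b})"
      and s: "s = alternating_word b a (m {a, b})" using rs by auto
    show ?thesis
    proof (cases "even (m {a, b})")
      case True
      then obtain k where "m {a, b} = k * 2" by (auto elim!: evenE simp: mult.commute)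
      then show ?thesis unfolding r s
        using edge[OF ab] by (simp add: word_value_alternating_heis algebra_simps)
    next
      case False
      then show ?thesis unfolding r s using odd[OF ab] by (intro word_value_alternating_eq) simp
    qed
  qed
  obtain h where "additive_on (presented_group (verts \<Lambda>) (artin_relations \<Lambda> m)) h"
    "\<And>w. w \<in> words (verts \<Lambda>) \<Longrightarrow> h (pres_cong (verts \<Lambda>) (artin_relations \<Lambda> m) `` {w}) = word_value ?f w"
    using presented_group_universal[of "artin_relations \<Lambda> m" ?f, OF rel] by blast
  then show ?thesis by (intro exI[of _ h]) (simp add: artin_group_def)
qed

lemma artin_additive_eqI:
  assumes "additive_on (artin_group \<Lambda> m) h" "additive_on (artin_group \<Lambda> m) h'"
    and eq: "\<And>x. x \<in> verts \<Lambda> \<Longrightarrow> h (artin_generator x) = h' (artin_generator x)" and "g \<in> carrier (artin_group \<Lambda> m)"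
  shows "h g = h' g"
proof -
  obtain w where w: "w \<in> words (verts \<Lambda>)" "g = pres_cong (verts \<Lambda>) (artin_relations \<Lambda> m) `` {w}"
    using assms(4) unfolding artin_group_def carrier_presented_group by auto
  have "word_value (\<lambda>x. h (artin_generator x)) w = word_value (\<lambda>x. h' (artin_generator x)) w"
    using w(1) by (induction w) (auto simp: eq)
  then show ?thesis
    using additive_presented_group[OF assms(1)[unfolded artin_group_def] w(1)]
      additive_presented_group[OF assms(2)[unfolded artin_group_def] w(1)] w(2) by simp
qed

lemma artin_independent_iff:
  assumes "additive_on (artin_group \<Lambda> m) a" "additive_on (artin_group \<Lambda> m) b"
  shows "independent_homs (artin_group \<Lambda> m) a b \<longleftrightarrow>
    (\<forall>s t. (\<forall>x\<in>verts \<Lambda>. s * a (artin_generator x) + t * b (artin_generator x) = 0) \<longrightarrow> s = 0 \<and> t = 0)"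
proof -
  have "(\<forall>x\<in>carrier (artin_group \<Lambda> m). s * a x + t * b x = 0) \<longleftrightarrow>
      (\<forall>x\<in>verts \<Lambda>. s * a (artin_generator x) + t * b (artin_generator x) = 0)" for s t
    using artin_additive_eqI[OF additive_linear(1)[OF assms, of s t], of "\<lambda>_. 0"] artin_generator_carrier
    by (auto simp: additive_on_def)
  then show ?thesis by (simp add: independent_homs_def)
qed

text \<open>Where \<alpha> is nonzero at both ends of an edge, the slope
  \<open>\<beta> / \<alpha>\<close> agrees there. The partner of \<open>\<alpha>'\<close> is \<beta>
  restricted to the zeros of \<alpha>, if that is nonzero. Otherwise it is the slope times
  \<open>\<alpha>'\<close>, if the slope varies on the support of \<open>\<alpha>'\<close>. If it
  does not vary, the partner is \<beta> minus the constant slope times \<alpha>.\<close>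

lemma artin_resonant_mono:
  assumes res: "resonant (artin_group \<Lambda> m) a" and a': "additive_on (artin_group \<Lambda> m) a'"
    and nz: "x0 \<in> verts \<Lambda>" "a' (artin_generator x0) \<noteq> 0"
    and supp: "\<And>x. x \<in> verts \<Lambda> \<Longrightarrow> a' (artin_generator x) \<noteq> 0 \<Longrightarrow> a (artin_generator x) \<noteq> 0"
  shows "resonant (artin_group \<Lambda> m) a'"
proof -
  let ?A = "artin_group \<Lambda> m"
  obtain h :: "_ \<Rightarrow> heis" where h: "additive_on ?A h" "\<forall>x\<in>carrier ?A. heis_x (h x) = a x"
      "independent_homs ?A a (heis_y \<circ> h)"
    using res by (auto simp: resonant_def)
  define \<alpha> where "\<alpha> x = heis_x (h (artin_generator x))" for x
  define \<beta> where "\<beta> x = heis_y (h (artin_generator x))" for x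
  define \<alpha>' where "\<alpha>' x = (if x \<in> verts \<Lambda> then a' (artin_generator x) else 0)" for x
  have supp: "\<alpha>' x = 0" if "\<alpha> x = 0" for x
    using that supp[of x] h(2) artin_generator_carrier[of x]
    by (cases "a' (artin_generator x) = 0") (auto simp: \<alpha>_def \<alpha>'_def)
  have edge: "\<alpha> x * \<beta> y = \<alpha> y * \<beta> x" if "x \<rightarrow>\<^bsub>\<Lambda>\<^esub> y" for x y
    unfolding \<alpha>_def \<beta>_def by (rule artin_additive_heis[OF h(1) that])
  have odd: "\<alpha> x = \<alpha> y" "\<beta> x = \<beta> y" "\<alpha>' x = \<alpha>' y" if "x \<rightarrow>\<^bsub>\<Lambda>\<^esub> y" "odd (m {x, y})" for x y
    using artin_additive_odd[OF additive_heis(1)[OF h(1)] that] artin_edge[OF that(1)]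
      artin_additive_odd[OF additive_heis(2)[OF h(1)] that] artin_additive_odd[OF a' that]
    by (simp_all add: \<alpha>_def \<beta>_def \<alpha>'_def)
  have ha: "additive_on ?A a"
    by (rule additive_cong[OF group_artin_group additive_heis(1)[OF h(1)]]) (simp add: h(2))
  have indep: "s = 0 \<and> t = 0" if "\<And>x. x \<in> verts \<Lambda> \<Longrightarrow> s * \<alpha> x + t * \<beta> x = 0" for s t
  proof -
    have "s * a (artin_generator x) + t * (heis_y \<circ> h) (artin_generator x) = 0" if "x \<in> verts \<Lambda>" for x
      using \<open>\<And>x. x \<in> verts \<Lambda> \<Longrightarrow> s * \<alpha> x + t * \<beta> x = 0\<close>[OF that] h(2) artin_generator_carrier[OF that]
      by (simp add: \<alpha>_def \<beta>_def)
    with h(3) show ?thesis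
      unfolding artin_independent_iff[OF ha additive_heis(2)[OF h(1)]] by blast
  qed
  have "\<exists>\<beta>'. (\<forall>x y. x \<rightarrow>\<^bsub>\<Lambda>\<^esub> y \<longrightarrow> \<alpha>' x * \<beta>' y = \<alpha>' y * \<beta>' x) \<and>
      (\<forall>x y. x \<rightarrow>\<^bsub>\<Lambda>\<^esub> y \<longrightarrow> odd (m {x, y}) \<longrightarrow> \<beta>' x = \<beta>' y) \<and>
      (\<forall>s t. (\<forall>x\<in>verts \<Lambda>. s * \<alpha>' x + t * \<beta>' x = 0) \<longrightarrow> s = 0 \<and> t = 0)"
  proof -
    have \<alpha>0: "\<alpha>' x0 \<noteq> 0" using nz by (simp add: \<alpha>'_def)
    \<comment> \<open>The case where all products over edges vanish; independence holds because at
      \<open>x0\<close> only \<open>\<alpha>'\<close> is nonzero and at \<open>x1\<close> only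
      \<open>\<beta>'\<close>.\<close>
    have disjoint: ?thesis
      if "\<And>x y. x \<rightarrow>\<^bsub>\<Lambda>\<^esub> y \<Longrightarrow> \<alpha>' x * \<beta>' y = 0 \<and> \<alpha>' y * \<beta>' x = 0"
        "\<And>x y. x \<rightarrow>\<^bsub>\<Lambda>\<^esub> y \<Longrightarrow> odd (m {x, y}) \<Longrightarrow> \<beta>' x = \<beta>' y"
        "\<beta>' x0 = 0" "x1 \<in> verts \<Lambda>" "\<alpha>' x1 = 0" "\<beta>' x1 \<noteq> 0" for \<beta>' x1
    proof (intro exI[of _ \<beta>'] conjI allI impI)
      fix x y assume "x \<rightarrow>\<^bsub>\<Lambda>\<^esub> y"
      from that(1)[OF this] show "\<alpha>' x * \<beta>' y = \<alpha>' y * \<beta>' x" by (elim conjE) (simp only:)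
    next
      fix s t assume st: "\<forall>x\<in>verts \<Lambda>. s * \<alpha>' x + t * \<beta>' x = 0"
      show "s = 0" using bspec[OF st nz(1)] that(3) \<alpha>0 by simp
      show "t = 0" using bspec[OF st that(4)] that(5,6) by simp
    qed (use that(2) in blast)
    define r where "r = \<beta> x0 / \<alpha> x0"
    show ?thesis
    proof (cases "\<exists>x\<in>verts \<Lambda>. \<alpha> x = 0 \<and> \<beta> x \<noteq> 0")
      case True
      \<comment> \<open>At a vertex with \<open>\<alpha> = 0\<close> and
        \<open>\<beta> \<noteq> 0\<close>, the edge equation forces \<alpha>, hence
        \<open>\<alpha>'\<close>, to vanish at all neighbours.\<close>
      then obtain x1 where "x1 \<in> verts \<Lambda>" "\<alpha> x1 = 0" "\<beta> x1 \<noteq> 0" by blast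
      then show ?thesis
      proof (intro disjoint[of "\<lambda>x. if \<alpha> x = 0 then \<beta> x else 0" x1])
        fix x y assume "x \<rightarrow>\<^bsub>\<Lambda>\<^esub> y"
        from edge[OF this] show "\<alpha>' x * (if \<alpha> y = 0 then \<beta> y else 0) = 0 \<and>
            \<alpha>' y * (if \<alpha> x = 0 then \<beta> x else 0) = 0"
          using supp[of x] supp[of y] by auto
      next
        fix x y assume "x \<rightarrow>\<^bsub>\<Lambda>\<^esub> y" "odd (m {x, y})"
        from odd(1,2)[OF this]
        show "(if \<alpha> x = 0 then \<beta> x else 0) = (if \<alpha> y = 0 then \<beta> y else 0)" by simp
      qed (use supp[of x0] supp[of x1] \<alpha>0 in auto)
    next
      case off: False
      show ?thesis
      proof (cases "\<exists>x\<in>verts \<Lambda>. \<alpha>' x \<noteq> 0 \<and> \<beta> x / \<alpha> x \<noteq> r")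
        case True
        then obtain x1 where x1: "x1 \<in> verts \<Lambda>" "\<alpha>' x1 \<noteq> 0" "\<beta> x1 / \<alpha> x1 \<noteq> r" by blast
        show ?thesis
        \<comment> \<open>Where \<alpha> vanishes so does \<open>\<alpha>'\<close>, and the value of
          the quotient there is immaterial.\<close>
        proof (intro exI[of _ "\<lambda>x. \<beta> x / \<alpha> x * \<alpha>' x"] conjI allI impI)
          fix x y assume "x \<rightarrow>\<^bsub>\<Lambda>\<^esub> y"
          from edge[OF this] show "\<alpha>' x * (\<beta> y / \<alpha> y * \<alpha>' y) = \<alpha>' y * (\<beta> x / \<alpha> x * \<alpha>' x)"
            using supp[of x] supp[of y] by (cases "\<alpha> x = 0"; cases "\<alpha> y = 0") (auto simp: field_simps)
        next
          fix s t assume "\<forall>x\<in>verts \<Lambda>. s * \<alpha>' x + t * (\<beta> x / \<alpha> x * \<alpha>' x) = 0"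
          then have "(s + t * (\<beta> x / \<alpha> x)) * \<alpha>' x = 0" if "x \<in> verts \<Lambda>" for x
            using that by (simp add: algebra_simps)
          from this[OF nz(1)] this[OF x1(1)] have "s + t * r = 0" "s + t * (\<beta> x1 / \<alpha> x1) = 0"
            using \<alpha>0 x1(2) by (auto simp: r_def)
          then have "t * (\<beta> x1 / \<alpha> x1 - r) = 0" by (simp add: algebra_simps)
          then have "t = 0" using x1(3) by simp
          then show "s = 0" "t = 0" using \<open>s + t * r = 0\<close> by auto
        qed (use odd in auto)
      next
        case False
        then have r: "\<beta> x = r * \<alpha> x" if "x \<in> verts \<Lambda>" "\<alpha>' x \<noteq> 0" for x
          using that supp by (metis nonzero_eq_divide_eq)
        \<comment> \<open>Subtracting a multiple of \<alpha> preserves the edge equations and here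
          kills \<beta> on the support of \<open>\<alpha>'\<close>; independence leaves a nonzero
          value elsewhere.\<close>
        define \<beta>' where "\<beta>' x = \<beta> x - r * \<alpha> x" for x
        obtain x1 where x1: "x1 \<in> verts \<Lambda>" "\<beta>' x1 \<noteq> 0"
          using indep[of "- r" 1] by (auto simp: \<beta>'_def)
        have edge': "\<alpha> x * \<beta>' y = \<alpha> y * \<beta>' x" if "x \<rightarrow>\<^bsub>\<Lambda>\<^esub> y" for x y
          using edge[OF that] by (simp add: \<beta>'_def algebra_simps)
        have zero: "\<beta>' x = 0" if "x \<in> verts \<Lambda>" "\<alpha>' x \<noteq> 0" for x
          using r[OF that] by (simp add: \<beta>'_def)
        have prod: "\<alpha>' x * \<beta>' y = 0" if "x \<in> verts \<Lambda>" "\<alpha> x * \<beta>' y = \<alpha> y * \<beta>' x" for x y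
          using that zero supp by (cases "\<alpha>' x = 0") auto
        show ?thesis
        proof (rule disjoint[of \<beta>' x1])
          fix x y assume xy: "x \<rightarrow>\<^bsub>\<Lambda>\<^esub> y"
          then show "\<alpha>' x * \<beta>' y = 0 \<and> \<alpha>' y * \<beta>' x = 0"
            using artin_edge[OF xy] edge'[OF xy] prod[of x y] prod[of y x] by simp
        next
          fix x y assume "x \<rightarrow>\<^bsub>\<Lambda>\<^esub> y" "odd (m {x, y})"
          from odd[OF this] show "\<beta>' x = \<beta>' y" by (simp add: \<beta>'_def)
        qed (use zero nz(1) \<alpha>0 x1 in auto)
      qed
    qed
  qed
  then obtain \<beta>' where \<beta>': "\<And>x y. x \<rightarrow>\<^bsub>\<Lambda>\<^esub> y \<Longrightarrow> \<alpha>' x * \<beta>' y = \<alpha>' y * \<beta>' x"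
      "\<And>x y. x \<rightarrow>\<^bsub>\<Lambda>\<^esub> y \<Longrightarrow> odd (m {x, y}) \<Longrightarrow> \<beta>' x = \<beta>' y"
      "\<And>s t. (\<forall>x\<in>verts \<Lambda>. s * \<alpha>' x + t * \<beta>' x = 0) \<Longrightarrow> s = 0 \<and> t = 0"
    by blast
  have "\<alpha>' x = \<alpha>' y \<and> \<beta>' x = \<beta>' y" if "x \<rightarrow>\<^bsub>\<Lambda>\<^esub> y" "odd (m {x, y})" for x y
    using odd(3)[OF that] \<beta>'(2)[OF that] by simp
  from artin_heis_hom_exists[of \<alpha>' \<beta>', OF this \<beta>'(1)]
  obtain h' where h': "additive_on ?A h'" "\<And>x. x \<in> verts \<Lambda> \<Longrightarrow> h' (artin_generator x) = Heis (\<alpha>' x) (\<beta>' x) 0"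
    by blast
  show ?thesis
    unfolding resonant_def
  proof (intro exI[of _ h'] conjI ballI)
    show "heis_x (h' x) = a' x" if "x \<in> carrier ?A" for x
      using artin_additive_eqI[OF additive_heis(1)[OF h'(1)] a' _ that] by (simp add: h'(2) \<alpha>'_def)
    show "independent_homs ?A a' (heis_y \<circ> h')"
      unfolding artin_independent_iff[OF a' additive_heis(2)[OF h'(1)]]
    proof (intro allI impI, rule \<beta>'(3))
      fix s t assume st: "\<forall>x\<in>verts \<Lambda>. s * a' (artin_generator x) + t * (heis_y \<circ> h') (artin_generator x) = 0"
      show "\<forall>x\<in>verts \<Lambda>. s * \<alpha>' x + t * \<beta>' x = 0"
      proof
        fix x assume "x \<in> verts \<Lambda>"
        then show "s * \<alpha>' x + t * \<beta>' x = 0"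
          using bspec[OF st, of x] h'(2)[of x] by (simp add: \<alpha>'_def)
      qed
    qed
  qed (rule h'(1))
qed

theorem coordinate_resonance_artin_group: "coordinate_resonance (artin_group \<Lambda> m)"
  unfolding coordinate_resonance_def
proof (intro exI[of _ "artin_generator ` verts \<Lambda>"] conjI allI impI)
  let ?A = "artin_group \<Lambda> m"
  show "finite (artin_generator ` verts \<Lambda>)"
    using \<Lambda> by (simp add: labelled_graph_def graph_def digraph_def fin_digraph.finite_verts)
  show "artin_generator ` verts \<Lambda> \<subseteq> carrier ?A" using artin_generator_carrier by blast
  {
    fix a a' :: "_ \<Rightarrow> real" assume a: "additive_on ?A a" "additive_on ?A a'"
    let ?\<alpha> = "\<lambda>x. if a' (artin_generator x) = 0 then 0 else a (artin_generator x)"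
    have "?\<alpha> x = ?\<alpha> y \<and> (0::real) = 0" if "x \<rightarrow>\<^bsub>\<Lambda>\<^esub> y" "odd (m {x, y})" for x y
      using artin_additive_odd[OF a(1) that] artin_additive_odd[OF a(2) that] by simp
    \<comment> \<open>The truncated function still agrees along odd edges; a zero second coordinate
      turns the Heisenberg lemma into one about real homomorphisms.\<close>
    from artin_heis_hom_exists[of ?\<alpha> "\<lambda>_. 0", OF this]
    obtain h where h: "additive_on ?A h" "\<And>x. x \<in> verts \<Lambda> \<Longrightarrow> h (artin_generator x) = Heis (?\<alpha> x) 0 0"
      by auto
    show "\<exists>b. additive_on ?A b \<and> (\<forall>y\<in>artin_generator ` verts \<Lambda>. b y = (if a' y = 0 then 0 else a y))"
      using additive_heis(1)[OF h(1)] h(2) by (intro exI[of _ "heis_x \<circ> h"]) auto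
  }
  fix a a' :: "_ \<Rightarrow> real"
  assume a: "resonant ?A a" "additive_on ?A a'" "\<exists>x\<in>carrier ?A. a' x \<noteq> 0"
    "\<forall>y\<in>artin_generator ` verts \<Lambda>. a' y \<noteq> 0 \<longrightarrow> a y \<noteq> 0"
  obtain x0 where "x0 \<in> verts \<Lambda>" "a' (artin_generator x0) \<noteq> 0"
    using artin_additive_eqI[OF a(2), of "\<lambda>_. 0"] a(3) by (auto simp: additive_on_def)
  then show "resonant ?A a'" using artin_resonant_mono[OF a(1,2)] a(4) by auto
qed

end

section \<open>Bestvina--Brady groups\<close>

context
  fixes G :: "('a, 'b) pre_digraph"
  assumes G: "graph G"
begin

abbreviation (input) "BB \<equiv> bestvina_brady G"

text \<open>The element \<open>u\<close> times the inverse of \<open>v\<close>, of height zero.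
  Nonadjacent pairs are allowed too, so that a base vertex turns any real homomorphism into a
  potential.\<close>

abbreviation bb_diff :: "'a \<Rightarrow> 'a \<Rightarrow> 'a word set" where
  "bb_diff u v \<equiv> raag_class G [(u, True), (v, False)]"

lemma carrier_raag: "carrier (raag G) = raag_class G ` words (verts G)"
  by (simp add: raag_def carrier_presented_group)

lemma raag_mult:
  "u \<in> words (verts G) \<Longrightarrow> v \<in> words (verts G) \<Longrightarrow>
    raag_class G u \<otimes>\<^bsub>raag G\<^esub> raag_class G v = raag_class G (u @ v)"
  by (simp add: raag_def presented_group_mult)

lemma raag_one: "\<one>\<^bsub>raag G\<^esub> = raag_class G []"
  by (simp add: raag_def presented_group_def)

lemma group_raag: "group (raag G)"
  by (simp add: raag_def group_presented_group)

lemma carrier_bestvina_brady: "x \<in> carrier BB \<longleftrightarrow> x \<in> carrier (raag G) \<and> raag_height x = 0"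
  by (simp add: bestvina_brady_def kernel_def integer_group_def)

lemma bestvina_brady_mult: "x \<otimes>\<^bsub>BB\<^esub> y = x \<otimes>\<^bsub>raag G\<^esub> y"
  by (simp add: bestvina_brady_def)

lemma raag_height_mult:
  "x \<in> carrier (raag G) \<Longrightarrow> y \<in> carrier (raag G) \<Longrightarrow>
    raag_height (x \<otimes>\<^bsub>raag G\<^esub> y) = raag_height x + raag_height y"
  using hom_mult[OF raag_height_hom] by (simp add: integer_group_def)

abbreviation raag_generator :: "'a \<Rightarrow> 'a word set" where
  "raag_generator x \<equiv> raag_class G [(x, True)]"

lemma raag_generator_carrier: "x \<in> verts G \<Longrightarrow> raag_generator x \<in> carrier (raag G)"
  unfolding carrier_raag by (rule imageI) simp

lemma raag_generator_inv:
  assumes "x \<in> verts G" shows "inv\<^bsub>raag G\<^esub> raag_generator x = raag_class G [(x, False)]"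
proof -
  interpret group "raag G" by (rule group_raag)
  have "([(x, False), (x, True)], []) \<in> pres_cong (verts G) R" for R
    using pres_cong.cancel[of "[]" "verts G" "[]" x False R] assms by simp
  then have "raag_class G ([(x, False)] @ [(x, True)]) = raag_class G []"
    by (auto intro!: equiv_class_eq[OF equiv_pres_cong])
  then have "raag_class G [(x, False)] \<otimes>\<^bsub>raag G\<^esub> raag_generator x = \<one>\<^bsub>raag G\<^esub>"
    using assms by (subst raag_mult) (auto simp: raag_one)
  then show ?thesis
    using assms by (intro inv_equality) (simp_all add: carrier_raag)
qed

lemma bb_diff_eq:
  assumes "u \<in> verts G" "v \<in> verts G"
  shows "bb_diff u v = raag_generator u \<otimes>\<^bsub>raag G\<^esub> inv\<^bsub>raag G\<^esub> raag_generator v"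
  using raag_mult[of "[(u, True)]" "[(v, False)]"] assms by (simp add: raag_generator_inv)

lemma bb_diff_carrier:
  assumes "u \<in> verts G" "v \<in> verts G" shows "bb_diff u v \<in> carrier BB"
proof -
  have "[(u, True), (v, False)] \<in> words (verts G)" using assms by simp
  then show ?thesis
    unfolding carrier_bestvina_brady carrier_raag
    by (intro conjI imageI) (simp_all only: raag_height_class, simp add: exponent_sum_def)
qed

lemma raag_generator_commute:
  assumes e: "u \<rightarrow>\<^bsub>G\<^esub> v"
  shows "raag_generator u \<otimes>\<^bsub>raag G\<^esub> raag_generator v = raag_generator v \<otimes>\<^bsub>raag G\<^esub> raag_generator u"
proof -
  interpret group "raag G" by (rule group_raag)
  let ?R = "{(commutator_word v w, []) |v w. v \<rightarrow>\<^bsub>G\<^esub> w}"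
  let ?u = "raag_generator u" and ?v = "raag_generator v"
  have uv: "u \<in> verts G" "v \<in> verts G" using graph_dominates_verts[OF G e] by auto
  have w: "commutator_word u v \<in> words (verts G)" using uv by (simp add: commutator_word_def)
  have "(commutator_word u v, []) \<in> pres_cong (verts G) ?R"
    using pres_cong.rel[of "[]" "verts G" "[]" "commutator_word u v" "[]" ?R] w e by auto
  then have "raag_class G (commutator_word u v) = raag_class G []"
    by (rule equiv_class_eq[OF equiv_pres_cong])
  then have "raag_class G (([(u, True)] @ [(v, True)]) @ ([(u, False)] @ [(v, False)])) = \<one>\<^bsub>raag G\<^esub>"
    by (simp add: commutator_word_def raag_one)
  then have "(?u \<otimes>\<^bsub>raag G\<^esub> ?v) \<otimes>\<^bsub>raag G\<^esub> (inv\<^bsub>raag G\<^esub> ?u \<otimes>\<^bsub>raag G\<^esub> inv\<^bsub>raag G\<^esub> ?v) = \<one>\<^bsub>raag G\<^esub>"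
    using uv by (simp add: raag_generator_inv raag_mult)
  moreover have "inv\<^bsub>raag G\<^esub> ?u \<otimes>\<^bsub>raag G\<^esub> inv\<^bsub>raag G\<^esub> ?v = inv\<^bsub>raag G\<^esub> (?v \<otimes>\<^bsub>raag G\<^esub> ?u)"
    using uv raag_generator_carrier by (simp add: inv_mult_group)
  ultimately show ?thesis
    using uv raag_generator_carrier inv_equality[of "?u \<otimes>\<^bsub>raag G\<^esub> ?v" "inv\<^bsub>raag G\<^esub> (?v \<otimes>\<^bsub>raag G\<^esub> ?u)"]
    by simp
qed

lemma bb_diff_mult:
  assumes "u \<in> verts G" "v \<in> verts G" "w \<in> verts G"
  shows "bb_diff u v \<otimes>\<^bsub>BB\<^esub> bb_diff v w = bb_diff u w"
proof -
  interpret group "raag G" by (rule group_raag)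
  show ?thesis
    using assms raag_generator_carrier
    by (simp add: bb_diff_eq bestvina_brady_mult word_simps)
qed

lemma bb_diff_commute:
  assumes e: "u \<rightarrow>\<^bsub>G\<^esub> v" "v \<rightarrow>\<^bsub>G\<^esub> w" "u \<rightarrow>\<^bsub>G\<^esub> w"
  shows "bb_diff u v \<otimes>\<^bsub>BB\<^esub> bb_diff v w = bb_diff v w \<otimes>\<^bsub>BB\<^esub> bb_diff u v"
proof -
  interpret group "raag G" by (rule group_raag)
  have V: "u \<in> verts G" "v \<in> verts G" "w \<in> verts G"
    using graph_dominates_verts[OF G] e by blast+
  show ?thesis
    using diff_commute[of "raag_generator u" "raag_generator v" "raag_generator w"]
      raag_generator_commute[OF e(1)] raag_generator_commute[OF e(2)] raag_generator_commute[OF e(3)]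
      raag_generator_carrier V
    by (simp add: bb_diff_eq bestvina_brady_mult)
qed

section \<open>Homomorphisms on the Bestvina--Brady group\<close>

lemma bb_additive_diff:
  fixes h :: "_ \<Rightarrow> real"
  assumes h: "additive_on BB h" and V: "u \<in> verts G" "v \<in> verts G" "w \<in> verts G"
  shows "h (bb_diff u v) + h (bb_diff v w) = h (bb_diff u w)"
  using additiveD[OF h bb_diff_carrier[OF V(1,2)] bb_diff_carrier[OF V(2,3)]] bb_diff_mult[OF V] by simp

lemma bb_additive_potential:
  fixes h :: "_ \<Rightarrow> real"
  assumes h: "additive_on BB h" and V: "u \<in> verts G" "v \<in> verts G" "r \<in> verts G"
  shows "h (bb_diff u v) = h (bb_diff u r) - h (bb_diff v r)"
  using bb_additive_diff[OF h V] by simp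

text \<open>Images of commuting elements commute, which in the Heisenberg group is the vanishing of
  the determinant of their first two coordinates.\<close>

lemma bb_additive_heis:
  fixes h :: "_ \<Rightarrow> heis"
  assumes h: "additive_on BB h" and e: "u \<rightarrow>\<^bsub>G\<^esub> v" "v \<rightarrow>\<^bsub>G\<^esub> w" "u \<rightarrow>\<^bsub>G\<^esub> w"
  shows "heis_x (h (bb_diff u v)) * heis_y (h (bb_diff v w)) =
    heis_x (h (bb_diff v w)) * heis_y (h (bb_diff u v))"
proof -
  have V: "u \<in> verts G" "v \<in> verts G" "w \<in> verts G"
    using graph_dominates_verts[OF G] e by blast+
  have c: "bb_diff u v \<in> carrier BB" "bb_diff v w \<in> carrier BB"
    using V by (auto intro: bb_diff_carrier)
  have "h (bb_diff u v) + h (bb_diff v w) = h (bb_diff v w) + h (bb_diff u v)"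
    using additiveD[OF h c] additiveD[OF h c(2,1)] bb_diff_commute[OF e] by simp
  from arg_cong[OF this, of heis_z] show ?thesis by simp
qed

text \<open>Built on the whole right-angled Artin group, where the edge condition makes the images
  of adjacent generators commute, and then restricted to the kernel; \<open>f\<close> and
  \<open>g\<close> become potentials.\<close>

lemma bb_heis_hom_exists:
  fixes f g :: "'a \<Rightarrow> real"
  assumes edge: "\<And>u v. u \<rightarrow>\<^bsub>G\<^esub> v \<Longrightarrow> f u * g v = f v * g u"
  shows "\<exists>h. additive_on BB h \<and> (\<forall>u\<in>verts G. \<forall>v\<in>verts G.
    heis_x (h (bb_diff u v)) = f u - f v \<and> heis_y (h (bb_diff u v)) = g u - g v)"
proof -
  let ?R = "{(commutator_word v w, []) |v w. v \<rightarrow>\<^bsub>G\<^esub> w}"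
  let ?f = "\<lambda>x. Heis (f x) (g x) 0"
  have rel: "word_value ?f r = word_value ?f s" if rs: "(r, s) \<in> ?R" for r s
  proof -
    obtain u v where "u \<rightarrow>\<^bsub>G\<^esub> v" "r = commutator_word u v" "s = []" using rs by auto
    then show ?thesis
      using edge[of u v] by (simp add: commutator_word_def zero_heis_def algebra_simps)
  qed
  obtain h where h: "additive_on (presented_group (verts G) ?R) h"
    "\<And>w. w \<in> words (verts G) \<Longrightarrow> h (pres_cong (verts G) ?R `` {w}) = word_value ?f w"
    using presented_group_universal[of ?R ?f, OF rel] by blast
  have "additive_on BB h"
    using h(1) unfolding additive_on_def raag_def[symmetric]
    by (auto simp: carrier_bestvina_brady bestvina_brady_mult)
  moreover have "heis_x (h (bb_diff u v)) = f u - f v" "heis_y (h (bb_diff u v)) = g u - g v"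
    if "u \<in> verts G" "v \<in> verts G" for u v
    using h(2)[of "[(u, True), (v, False)]"] that by (simp_all add: zero_heis_def)
  ultimately show ?thesis by blast
qed

lemma bb_hom_exists:
  fixes f :: "'a \<Rightarrow> real"
  shows "\<exists>h. additive_on BB h \<and> (\<forall>u\<in>verts G. \<forall>v\<in>verts G. h (bb_diff u v) = f u - f v)"
proof -
  obtain h where h: "additive_on BB h"
    "\<forall>u\<in>verts G. \<forall>v\<in>verts G. heis_x (h (bb_diff u v)) = f u - f v \<and> heis_y (h (bb_diff u v)) = 0 - 0"
    using bb_heis_hom_exists[of f "\<lambda>_. 0"] by auto
  then show ?thesis using additive_heis(1)[OF h(1)] by (intro exI[of _ "heis_x \<circ> h"]) simp
qed

text \<open>
  Conjugation by a vertex \<open>p\<close> fixes the differences along the edges at \<open>p\<close>. A power of \<open>r\<close>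
  differs from the same power of \<open>p\<close> by an element of the kernel, so in a connected graph the
  conjugates of all edge differences by powers of \<open>r\<close> have the same image as the differences.
\<close>

lemma bb_additive_eq_0:
  fixes h :: "_ \<Rightarrow> real"
  assumes con: "Digraph_Component.connected G" and h: "additive_on BB h"
    and edge: "\<And>u v. u \<rightarrow>\<^bsub>G\<^esub> v \<Longrightarrow> h (bb_diff u v) = 0" and x: "x \<in> carrier BB"
  shows "h x = 0"
proof -
  interpret group "raag G" by (rule group_raag)
  interpret ht: group_hom "raag G" integer_group raag_height
    by (simp add: group_hom_def group_hom_axioms_def raag_height_hom group_raag)
  let ?A = "raag G" and ?g = raag_generator
  interpret graph G by (rule G)
  obtain r where r: "r \<in> verts G" using con connected_iff_closed_sets by blast
  have gc: "?g v \<in> carrier ?A" if "v \<in> verts G" for v using that by (rule raag_generator_carrier)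
  have ht_pow: "raag_height (?g v [^]\<^bsub>?A\<^esub> (k::int)) = k" if "v \<in> verts G" for v k
    using ht.hom_int_pow[OF gc[OF that], of k] raag_height_generator[OF that]
    by simp
  have ht_inv: "raag_height (inv\<^bsub>?A\<^esub> y) = - raag_height y" if "y \<in> carrier ?A" for y
    using ht.hom_inv[OF that] by simp
  have mem: "y \<in> carrier ?A" if "y \<in> carrier BB" for y using that carrier_bestvina_brady by blast
  have hm: "h (y \<otimes>\<^bsub>?A\<^esub> z) = h y + h z" if "y \<in> carrier BB" "z \<in> carrier BB" for y z
    using additiveD[OF h that] by (simp add: bestvina_brady_mult)
  have bbm: "y \<otimes>\<^bsub>?A\<^esub> z \<in> carrier BB" if "y \<in> carrier BB" "z \<in> carrier BB" for y z
    using that raag_height_mult by (auto simp: carrier_bestvina_brady)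
  have bbi: "inv\<^bsub>?A\<^esub> y \<in> carrier BB" if "y \<in> carrier BB" for y
    using that ht_inv by (auto simp: carrier_bestvina_brady)
  have one: "\<one>\<^bsub>?A\<^esub> \<in> carrier BB" by (auto simp: carrier_bestvina_brady ht.hom_one[simplified])
  have h1: "h \<one>\<^bsub>?A\<^esub> = 0" using hm[OF one one] by simp
  have hi: "h (inv\<^bsub>?A\<^esub> y) = - h y" if "y \<in> carrier BB" for y
    using hm[OF bbi[OF that] that] h1 mem[OF that] by simp
  define cj where "cj k y = ?g r [^]\<^bsub>?A\<^esub> (k::int) \<otimes>\<^bsub>?A\<^esub> y \<otimes>\<^bsub>?A\<^esub> inv\<^bsub>?A\<^esub> (?g r [^]\<^bsub>?A\<^esub> k)" for k y
  have cj_bb: "cj k y \<in> carrier BB" if "y \<in> carrier BB" for k y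
    using that mem[OF that] gc[OF r] ht_inv raag_height_mult
    unfolding cj_def by (auto simp: carrier_bestvina_brady)
  have cj_mult: "cj k (y \<otimes>\<^bsub>?A\<^esub> z) = cj k y \<otimes>\<^bsub>?A\<^esub> cj k z" if "y \<in> carrier ?A" "z \<in> carrier ?A" for k y z
    unfolding cj_def using that gc[OF r] by (simp add: m_assoc inv_solve_left)
  have cj_edge: "h (cj k (bb_diff u v)) = 0" if e: "u \<rightarrow>\<^bsub>G\<^esub> v" for u v k
  proof -
    have V: "u \<in> verts G" "v \<in> verts G" using graph_dominates_verts[OF G e] by auto
    let ?d = "bb_diff u v"
    have d: "?d \<in> carrier BB" using V by (rule bb_diff_carrier)
    have du: "?g u \<otimes>\<^bsub>?A\<^esub> ?d = ?d \<otimes>\<^bsub>?A\<^esub> ?g u"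
      unfolding bb_diff_eq[OF V]
      using commute_inv[of "?g v" "?g u"] raag_generator_commute[OF e] gc[OF V(1)] gc[OF V(2)]
      by (simp add: m_assoc)
    let ?y = "?g r [^]\<^bsub>?A\<^esub> k \<otimes>\<^bsub>?A\<^esub> inv\<^bsub>?A\<^esub> (?g u [^]\<^bsub>?A\<^esub> k)"
    have y: "?y \<in> carrier BB"
      using gc[OF r] gc[OF V(1)] ht_inv ht_pow[OF r] ht_pow[OF V(1)] raag_height_mult
      by (simp add: carrier_bestvina_brady)
    have "cj k ?d = ?y \<otimes>\<^bsub>?A\<^esub> ?d \<otimes>\<^bsub>?A\<^esub> inv\<^bsub>?A\<^esub> ?y"
      unfolding cj_def
      by (rule conjugate_shift) (use gc[OF r] gc[OF V(1)] mem[OF d] commute_int_pow[OF _ _ du] in auto)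
    then show ?thesis
      using hm[OF bbm[OF y d] bbi[OF y]] hm[OF y d] hi[OF y] edge[OF e] by simp
  qed
  have cj_diff: "h (cj k (bb_diff p r)) = 0" if "p \<in> verts G" for p k
  proof -
    have "\<forall>k. h (cj k (bb_diff p r)) = 0"
    proof (rule connected_closed_set[where P="\<lambda>p. \<forall>k. h (cj k (bb_diff p r)) = 0", OF G con r _ _ that])
      show "\<forall>k. h (cj k (bb_diff r r)) = 0"
        using gc[OF r] h1 by (simp add: bb_diff_eq[OF r r] cj_def)
      fix p q assume e: "p \<rightarrow>\<^bsub>G\<^esub> q" and IH: "\<forall>k. h (cj k (bb_diff p r)) = 0"
      have V: "p \<in> verts G" "q \<in> verts G" using graph_dominates_verts[OF G e] by auto
      have d: "bb_diff q p \<in> carrier BB" "bb_diff p r \<in> carrier BB" using V r bb_diff_carrier by auto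
      have "cj k (bb_diff q r) = cj k (bb_diff q p) \<otimes>\<^bsub>?A\<^esub> cj k (bb_diff p r)" for k
        using bb_diff_mult[OF V(2,1) r] cj_mult[OF mem[OF d(1)] mem[OF d(2)]]
        by (simp add: bestvina_brady_mult)
      then show "\<forall>k. h (cj k (bb_diff q r)) = 0"
        using IH hm[OF cj_bb[OF d(1)] cj_bb[OF d(2)]] cj_edge[OF graph_dominates_sym[OF G e]] by simp
    qed
    then show ?thesis by blast
  qed
  \<comment> \<open>The splitting into kernel and powers of \<open>r\<close>, strengthened by the
    claim that \<open>h\<close> vanishes on the kernel part.\<close>
  have normal_form: "\<exists>y\<in>carrier BB. h y = 0 \<and> (\<exists>k::int. raag_class G w = y \<otimes>\<^bsub>?A\<^esub> ?g r [^]\<^bsub>?A\<^esub> k)"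
    if "w \<in> words (verts G)" for w
    using that
  proof (induction w rule: rev_induct)
    case Nil
    then show ?case
      by (intro bexI[of _ "\<one>\<^bsub>?A\<^esub>"] conjI exI[of _ 0]) (simp_all add: h1 one flip: raag_one)
  next
    case (snoc p w)
    obtain v b where p: "p = (v, b)" by (cases p)
    have V: "v \<in> verts G" "w \<in> words (verts G)" using snoc.prems p by auto
    obtain y and k :: int where y: "y \<in> carrier BB" "h y = 0" "raag_class G w = y \<otimes>\<^bsub>?A\<^esub> ?g r [^]\<^bsub>?A\<^esub> k"
      using snoc.IH[OF V(2)] by blast
    let ?d = "bb_diff v r"
    have d: "?d \<in> carrier BB" using V(1) r by (rule bb_diff_carrier)
    have c: "y \<in> carrier ?A" "?g r \<in> carrier ?A" "?g v \<in> carrier ?A" "?d \<in> carrier ?A"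
      by (fact mem[OF y(1)] gc[OF r] gc[OF V(1)] mem[OF d])+
    have gv: "?g v = ?d \<otimes>\<^bsub>?A\<^esub> ?g r"
      unfolding bb_diff_eq[OF V(1) r] using c by (simp add: m_assoc)
    have rw: "raag_class G (w @ [p]) = y \<otimes>\<^bsub>?A\<^esub> ?g r [^]\<^bsub>?A\<^esub> k \<otimes>\<^bsub>?A\<^esub> raag_class G [p]"
      using V p by (simp add: y(3)[symmetric] raag_mult)
    show ?case
    proof (cases b)
      case True
      have "raag_class G (w @ [p]) = (y \<otimes>\<^bsub>?A\<^esub> cj k ?d) \<otimes>\<^bsub>?A\<^esub> ?g r [^]\<^bsub>?A\<^esub> (k + 1)"
        unfolding rw using True p c by (simp add: gv cj_def int_pow_mult word_simps)
      moreover have "h (y \<otimes>\<^bsub>?A\<^esub> cj k ?d) = 0" "y \<otimes>\<^bsub>?A\<^esub> cj k ?d \<in> carrier BB"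
        using hm[OF y(1) cj_bb[OF d]] y(2) cj_diff[OF V(1)] bbm[OF y(1) cj_bb[OF d]] by simp_all
      ultimately show ?thesis by blast
    next
      case False
      \<comment> \<open>As the generator \<open>v\<close> is \<open>?d\<close> times
        \<open>r\<close>, its inverse starts with the inverse of \<open>r\<close>. The exponent
        therefore drops before the inverse of \<open>?d\<close> is conjugated, and
        \<open>k - 1\<close> appears in both places.\<close>
      have "raag_class G (w @ [p]) = (y \<otimes>\<^bsub>?A\<^esub> inv\<^bsub>?A\<^esub> (cj (k - 1) ?d)) \<otimes>\<^bsub>?A\<^esub> ?g r [^]\<^bsub>?A\<^esub> (k - 1)"
      proof -
        have "k = (k - 1) + 1" by simp
        then have k: "?g r [^]\<^bsub>?A\<^esub> k = ?g r [^]\<^bsub>?A\<^esub> (k - 1) \<otimes>\<^bsub>?A\<^esub> ?g r"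
          using int_pow_mult[OF c(2), of "k - 1" 1] c(2) by simp
        have "raag_class G [p] = inv\<^bsub>?A\<^esub> ?g v" using False p V raag_generator_inv by simp
        then show ?thesis
          unfolding rw k using c by (simp add: gv cj_def word_simps)
      qed
      moreover have "h (y \<otimes>\<^bsub>?A\<^esub> inv\<^bsub>?A\<^esub> (cj (k - 1) ?d)) = 0" "y \<otimes>\<^bsub>?A\<^esub> inv\<^bsub>?A\<^esub> (cj (k - 1) ?d) \<in> carrier BB"
        using hm[OF y(1) bbi[OF cj_bb[OF d]]] hi[OF cj_bb[OF d]] y(2) cj_diff[OF V(1)]
          bbm[OF y(1) bbi[OF cj_bb[OF d]]] by simp_all
      ultimately show ?thesis by blast
    qed
  qed
  obtain w where w: "w \<in> words (verts G)" "x = raag_class G w"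
    using mem[OF x] carrier_raag by auto
  obtain y and k :: int where y: "y \<in> carrier BB" "h y = 0" "x = y \<otimes>\<^bsub>?A\<^esub> ?g r [^]\<^bsub>?A\<^esub> k"
    using normal_form[OF w(1)] unfolding w(2) by blast
  have "raag_height x = k"
    using y(1,3) raag_height_mult[OF mem[OF y(1)] int_pow_closed[OF gc[OF r]]] ht_pow[OF r]
    by (simp add: carrier_bestvina_brady)
  then have "k = 0" using x carrier_bestvina_brady by auto
  then show ?thesis using y mem[OF y(1)] by simp
qed

lemma bb_additive_eqI:
  fixes h h' :: "_ \<Rightarrow> real"
  assumes con: "Digraph_Component.connected G" and h: "additive_on BB h" "additive_on BB h'"
    and eq: "\<And>u v. u \<rightarrow>\<^bsub>G\<^esub> v \<Longrightarrow> h (bb_diff u v) = h' (bb_diff u v)" and x: "x \<in> carrier BB"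
  shows "h x = h' x"
proof -
  have "h (bb_diff u v) - h' (bb_diff u v) = 0" if "u \<rightarrow>\<^bsub>G\<^esub> v" for u v
    using eq[OF that] by simp
  from bb_additive_eq_0[OF con additive_linear(2)[OF h] this x] show ?thesis by simp
qed

end

section \<open>Separators as coordinate subspaces\<close>

text \<open>Each index excludes at most one nonzero \<open>t\<close>, so finitely many values are
  forbidden.\<close>

lemma generic_perturbation:
  fixes p q :: "'i \<Rightarrow> real"
  assumes "finite I" "\<And>i. i \<in> I \<Longrightarrow> p i \<noteq> 0"
  obtains t where "t \<noteq> 0" "\<And>i. i \<in> I \<Longrightarrow> p i + t * q i \<noteq> 0"
proof -
  have "finite (insert 0 ((\<lambda>i. - p i / q i) ` I))" using assms(1) by simp
  then obtain t where t: "t \<notin> insert 0 ((\<lambda>i. - p i / q i) ` I)"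
    using ex_new_if_finite[OF infinite_UNIV_char_0] by blast
  show ?thesis
  proof (rule that)
    show "t \<noteq> 0" using t by simp
    fix i assume i: "i \<in> I"
    show "p i + t * q i \<noteq> 0"
    proof (cases "q i = 0")
      case False
      have "t \<noteq> - p i / q i" using t i by blast
      then show ?thesis using False by (simp add: field_simps add_eq_0_iff)
    qed (use assms(2)[OF i] in simp)
  qed
qed

text \<open>The potential of \<open>a\<close> is constant on \<open>L\<close>. All pairs are used,
  not only edges, so that this is the meaning even if \<open>L\<close> is not connected.\<close>

definition vanishes_on_separator ::
    "('a, 'b) pre_digraph \<Rightarrow> ('a, 'b) pre_digraph \<Rightarrow> ('a word set \<Rightarrow> real) \<Rightarrow> bool" where
  "vanishes_on_separator G L a \<longleftrightarrow> additive_on (bestvina_brady G) a \<and>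
     (\<forall>u\<in>verts L. \<forall>v\<in>verts L. a (bb_diff G u v) = 0)"

definition mixed_pairs ::
    "('a, 'b) pre_digraph \<Rightarrow> ('a, 'b) pre_digraph \<Rightarrow> ('a \<times> 'a) set" where
  "mixed_pairs G L =
     {(u, v). u \<in> verts G \<and> v \<in> verts G \<and> u \<noteq> v \<and> \<not> (u \<in> verts L \<and> v \<in> verts L)}"

text \<open>The potential coincides only where vanishing on \<open>L\<close> forces it to. Finitely
  many nonvanishing conditions survive a generic perturbation.\<close>

definition generic_on_separator ::
    "('a, 'b) pre_digraph \<Rightarrow> ('a, 'b) pre_digraph \<Rightarrow> ('a word set \<Rightarrow> real) \<Rightarrow> bool" where
  "generic_on_separator G L a \<longleftrightarrow>
     vanishes_on_separator G L a \<and> (\<forall>(u, v)\<in>mixed_pairs G L. a (bb_diff G u v) \<noteq> 0)"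

context
  fixes G :: "('a, 'b) pre_digraph" and L :: "('a, 'b) pre_digraph"
  assumes G: "graph G" and bi: "biconnected G"
    and sc: "simply_connected (realization (flag_complex G))"
    and L: "minimal_full_separating G L" and L_nonempty: "verts L \<noteq> {}"
begin

lemma connected_G: "Digraph_Component.connected G"
  using bi by (rule biconnected_connected)

lemma separator_verts: "verts L \<subseteq> verts G"
  using L by (auto simp: minimal_full_separating_def separating_def subgraph_def)

lemma finite_mixed_pairs: "finite (mixed_pairs G L)"
  by (rule finite_subset[of _ "verts G \<times> verts G"])
    (auto simp: mixed_pairs_def finite_verts_graph[OF G])

text \<open>Normalise the potential \<open>f\<close> to 0 on \<open>L\<close> and cut it off outside
  a union \<open>A\<close> of components of the complement. Edges leaving \<open>A\<close> end in
  \<open>L\<close>, where \<open>f\<close> is 0, so the cut-off \<open>g\<close> satisfies the edge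
  condition. It is independent of \<open>f\<close>, which is nonzero both on \<open>A\<close> and on
  the rest of the complement.\<close>

lemma generic_resonant:
  assumes "generic_on_separator G L a" shows "resonant (bestvina_brady G) a"
proof -
  have a: "additive_on (bestvina_brady G) a" and van: "\<And>u v. u \<in> verts L \<Longrightarrow> v \<in> verts L \<Longrightarrow> a (bb_diff G u v) = 0"
    and gen: "\<And>u v. (u, v) \<in> mixed_pairs G L \<Longrightarrow> a (bb_diff G u v) \<noteq> 0"
    using assms by (auto simp: generic_on_separator_def vanishes_on_separator_def)
  obtain l where l: "l \<in> verts L" using L_nonempty by blast
  then have lG: "l \<in> verts G" using separator_verts by blast
  define f where "f u = a (bb_diff G u l)" for u
  have af: "a (bb_diff G u v) = f u - f v" if "u \<in> verts G" "v \<in> verts G" for u v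
    unfolding f_def using bb_additive_potential[OF G a that lG] .
  have fL: "f u = 0" if "u \<in> verts L" for u using van[OF that l] by (simp add: f_def)
  have fne: "f u \<noteq> 0" if "u \<in> verts G - verts L" for u
    unfolding f_def by (rule gen) (use that lG l in \<open>auto simp: mixed_pairs_def\<close>)
  have "disconnected (G \<restriction> (verts G - verts L))"
    using L by (simp add: minimal_full_separating_def separating_def)
  then obtain A where A: "A \<subseteq> verts G - verts L" "A \<noteq> {}" "A \<noteq> verts G - verts L"
      "\<forall>u\<in>A. \<forall>v\<in>verts G - verts L. u \<rightarrow>\<^bsub>G\<^esub> v \<longrightarrow> v \<in> A"
    by (subst (asm) disconnected_induce_iff[OF G]) auto
  define g where "g u = (if u \<in> A then f u else 0)" for u
  have edge: "f u * g v = f v * g u" if e: "u \<rightarrow>\<^bsub>G\<^esub> v" for u v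
  proof -
    have V: "u \<in> verts G" "v \<in> verts G" using graph_dominates_verts[OF G e] by auto
    have "f v = 0" if "u \<in> A" "v \<notin> A" using A(4) that V e fL by blast
    moreover have "f u = 0" if "v \<in> A" "u \<notin> A"
      using A(4) that V graph_dominates_sym[OF G e] fL by blast
    ultimately show ?thesis by (auto simp: g_def)
  qed
  obtain h where h: "additive_on (bestvina_brady G) h" and hd: "\<And>u v. u \<in> verts G \<Longrightarrow> v \<in> verts G \<Longrightarrow>
      heis_x (h (bb_diff G u v)) = f u - f v \<and> heis_y (h (bb_diff G u v)) = g u - g v"
    using bb_heis_hom_exists[OF G, of f g, OF edge] by blast
  show ?thesis
    unfolding resonant_def
  proof (intro exI[of _ h] conjI ballI)
    fix x assume x: "x \<in> carrier (bestvina_brady G)"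
    have "(heis_x \<circ> h) x = a x"
    proof (rule bb_additive_eqI[OF G connected_G additive_heis(1)[OF h] a _ x])
      fix u v assume "u \<rightarrow>\<^bsub>G\<^esub> v"
      then have "u \<in> verts G" "v \<in> verts G" using graph_dominates_verts[OF G] by blast+
      then show "(heis_x \<circ> h) (bb_diff G u v) = a (bb_diff G u v)" by (simp add: hd af)
    qed
    then show "heis_x (h x) = a x" by simp
  next
    show "independent_homs (bestvina_brady G) a (heis_y \<circ> h)"
      unfolding independent_homs_def
    proof (intro allI impI)
      fix s t assume st: "\<forall>x\<in>carrier (bestvina_brady G). s * a x + t * (heis_y \<circ> h) x = 0"
      have eq: "s * f u + t * g u = 0" if "u \<in> verts G" for u
      proof -
        have "g l = 0" using A(1) l by (auto simp: g_def)
        then show ?thesis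
          using bspec[OF st bb_diff_carrier[OF G that lG]] hd[OF that lG] af[OF that lG] fL[OF l] by simp
      qed
      obtain w where w: "w \<in> verts G - verts L" "w \<notin> A" using A(1,3) by blast
      obtain z where z: "z \<in> A" "z \<in> verts G - verts L" using A(1,2) by blast
      have "s = 0" using eq[of w] fne[OF w(1)] w by (simp add: g_def)
      moreover have "t = 0" using eq[of z] fne[OF z(2)] z \<open>s = 0\<close> by (simp add: g_def)
      ultimately show "s = 0 \<and> t = 0" by blast
    qed
  qed (rule h)
qed

text \<open>The plane map consists of the potentials of \<open>a\<close> and of its partner. A
  linear relation between them on edges would extend to the whole kernel by
  \<open>bb_additive_eq_0\<close>, so independence carries over to edges.\<close>

lemma resonant_vanishes_on_separator:
  assumes res: "resonant (bestvina_brady G) a" and add: "additive_on (bestvina_brady G) a"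
    and gen: "\<And>u v. (u, v) \<in> mixed_pairs G L \<Longrightarrow> a (bb_diff G u v) \<noteq> 0"
  shows "vanishes_on_separator G L a"
proof -
  obtain h :: "_ \<Rightarrow> heis" where h: "additive_on (bestvina_brady G) h" "\<forall>x\<in>carrier (bestvina_brady G). heis_x (h x) = a x"
      "independent_homs (bestvina_brady G) a (heis_y \<circ> h)"
    using res by (auto simp: resonant_def)
  obtain l where l: "l \<in> verts L" using L_nonempty by blast
  then have lG: "l \<in> verts G" using separator_verts by blast
  define F where "F u = a (bb_diff G u l)" for u
  define K where "K u = heis_y (h (bb_diff G u l))" for u
  have aF: "a (bb_diff G u v) = F u - F v" if "u \<in> verts G" "v \<in> verts G" for u v
    unfolding F_def using bb_additive_potential[OF G add that lG] .
  have xF: "heis_x (h (bb_diff G u v)) = F u - F v" if "u \<in> verts G" "v \<in> verts G" for u v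
    using h(2) bb_diff_carrier[OF G that] aF[OF that] by simp
  have yK: "heis_y (h (bb_diff G u v)) = K u - K v" if "u \<in> verts G" "v \<in> verts G" for u v
    unfolding K_def using bb_additive_potential[OF G additive_heis(2)[OF h(1)] that lG] by simp
  have "F u = F v" if uv: "u \<in> verts L" "v \<in> verts L" for u v
  proof (rule potential_constant_on_separator[OF G _ bi sc L _ _ uv])
    fix u v w assume e: "u \<rightarrow>\<^bsub>G\<^esub> v" "v \<rightarrow>\<^bsub>G\<^esub> w" "u \<rightarrow>\<^bsub>G\<^esub> w"
    have V: "u \<in> verts G" "v \<in> verts G" "w \<in> verts G" using graph_dominates_verts[OF G] e by blast+
    show "(F u - F v) * (K v - K w) = (F v - F w) * (K u - K v)"
      using bb_additive_heis[OF G h(1) e] by (simp add: xF yK V)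
  next
    fix u v assume e: "u \<rightarrow>\<^bsub>G\<^esub> v" "\<not> (u \<in> verts L \<and> v \<in> verts L)"
    then have "(u, v) \<in> mixed_pairs G L" using graph_dominates_verts[OF G e(1)] by (simp add: mixed_pairs_def)
    then show "F u \<noteq> F v" using gen aF graph_dominates_verts[OF G e(1)] by fastforce
  next
    fix p q assume pq: "\<And>u v. u \<rightarrow>\<^bsub>G\<^esub> v \<Longrightarrow> p * (F u - F v) + q * (K u - K v) = 0"
    have "p * a x + q * (heis_y \<circ> h) x = 0" if "x \<in> carrier (bestvina_brady G)" for x
    proof (rule bb_additive_eq_0[OF G connected_G additive_linear(1)[OF add additive_heis(2)[OF h(1)]] _ that])
      fix u v assume e: "u \<rightarrow>\<^bsub>G\<^esub> v"
      have V: "u \<in> verts G" "v \<in> verts G" using graph_dominates_verts[OF G e] by auto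
      show "p * a (bb_diff G u v) + q * (heis_y \<circ> h) (bb_diff G u v) = 0"
        using pq[OF e] by (simp add: aF yK V)
    qed
    then show "p = 0 \<and> q = 0" using h(3) unfolding independent_homs_def by blast
  qed
  then show ?thesis
    unfolding vanishes_on_separator_def
  proof (intro conjI ballI add)
    fix u v assume uv: "u \<in> verts L" "v \<in> verts L"
    then have "u \<in> verts G" "v \<in> verts G" using separator_verts by blast+
    then show "a (bb_diff G u v) = 0" using aF \<open>\<And>u v. u \<in> verts L \<Longrightarrow> v \<in> verts L \<Longrightarrow> F u = F v\<close>[OF uv] by simp
  qed
qed

lemma generic_exists: "\<exists>a. generic_on_separator G L a"
proof -
  have "finite (verts G)" by (rule finite_verts_graph[OF G])
  then obtain i :: "'a \<Rightarrow> nat" where i: "inj_on i (verts G)"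
    using finite_imp_inj_to_nat_seg by blast
  \<comment> \<open>\<open>Suc\<close> keeps the distinct values off \<open>L\<close> away from the
    value 0 on \<open>L\<close>.\<close>
  let ?f = "\<lambda>u. if u \<in> verts L then 0 else real (Suc (i u))"
  obtain a where a: "additive_on (bestvina_brady G) a"
    "\<And>u v. u \<in> verts G \<Longrightarrow> v \<in> verts G \<Longrightarrow> a (bb_diff G u v) = ?f u - ?f v"
    using bb_hom_exists[OF G, of ?f] by blast
  have "a (bb_diff G u v) \<noteq> 0" if "(u, v) \<in> mixed_pairs G L" for u v
    using that a(2)[of u v] inj_onD[OF i, of u v] by (auto simp: mixed_pairs_def)
  moreover have "vanishes_on_separator G L a"
    using a separator_verts by (auto simp: vanishes_on_separator_def subset_iff)
  ultimately show ?thesis by (auto simp: generic_on_separator_def)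
qed

text \<open>
  Among the generic homomorphisms take one with the most nonzero coordinates. Perturbing it shows
  that its support contains every homomorphism vanishing on the separator, and, as perturbations
  within its support stay resonant, that nothing else is supported there.
\<close>

lemma separator_coordinate_subspace:
  assumes E: "finite E"
    and mono: "\<And>a a'. resonant (bestvina_brady G) a \<Longrightarrow> additive_on (bestvina_brady G) a' \<Longrightarrow> \<exists>x\<in>carrier (bestvina_brady G). a' x \<noteq> 0 \<Longrightarrow>
        \<forall>e\<in>E. a' e \<noteq> 0 \<longrightarrow> a e \<noteq> 0 \<Longrightarrow> resonant (bestvina_brady G) a'"
  obtains a0 :: "'a word set \<Rightarrow> real" where "additive_on (bestvina_brady G) a0"
    and "\<And>a. vanishes_on_separator G L a \<longleftrightarrow> additive_on (bestvina_brady G) a \<and> (\<forall>e\<in>E. a e \<noteq> 0 \<longrightarrow> a0 e \<noteq> 0)"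
proof -
  let ?supp = "\<lambda>a. {e \<in> E. a e \<noteq> (0::real)}"
  have "\<exists>a0. generic_on_separator G L a0 \<and>
      (\<forall>a. generic_on_separator G L a \<longrightarrow> card (?supp a) \<le> card (?supp a0))"
  proof (rule ex_has_greatest_nat[where b = "Suc (card E)"])
    show "generic_on_separator G L (SOME a. generic_on_separator G L a)"
      using generic_exists by (rule someI_ex)
    show "\<forall>a. generic_on_separator G L a \<longrightarrow> card (?supp a) < Suc (card E)"
      using E by (auto simp: less_Suc_eq_le intro: card_mono)
  qed
  then obtain a0 where gen0: "generic_on_separator G L a0"
    and max: "\<And>a. generic_on_separator G L a \<Longrightarrow> card (?supp a) \<le> card (?supp a0)" by blast
  have add0: "additive_on (bestvina_brady G) a0" and van0: "\<And>u v. u \<in> verts L \<Longrightarrow> v \<in> verts L \<Longrightarrow> a0 (bb_diff G u v) = 0"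
    and mix0: "\<And>u v. (u, v) \<in> mixed_pairs G L \<Longrightarrow> a0 (bb_diff G u v) \<noteq> 0"
    using gen0 by (auto simp: generic_on_separator_def vanishes_on_separator_def)
  have supp_sub: "\<forall>e\<in>E. a e \<noteq> 0 \<longrightarrow> a0 e \<noteq> 0" if a: "vanishes_on_separator G L a" for a
  proof (rule ccontr)
    assume "\<not> ?thesis"
    then obtain e1 where e1: "e1 \<in> E" "a e1 \<noteq> 0" "a0 e1 = 0" by blast
    let ?I = "(\<lambda>(u, v). bb_diff G u v) ` mixed_pairs G L \<union> ?supp a0"
    have "finite ?I" using finite_mixed_pairs E by simp
    moreover have "a0 i \<noteq> 0" if "i \<in> ?I" for i using that mix0 by auto
    ultimately obtain t where t: "t \<noteq> 0" "\<And>i. i \<in> ?I \<Longrightarrow> a0 i + t * a i \<noteq> 0"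
      using generic_perturbation[of ?I a0 a] by blast
    let ?b = "\<lambda>x. a0 x + t * a x"
    have "additive_on (bestvina_brady G) ?b"
      using additive_linear(1)[of "bestvina_brady G" a0 a 1 t] add0 a by (simp add: vanishes_on_separator_def)
    then have "generic_on_separator G L ?b"
      using t(2) van0 a by (auto simp: generic_on_separator_def vanishes_on_separator_def)
    then have "card (?supp ?b) \<le> card (?supp a0)" by (rule max)
    \<comment> \<open>The perturbation keeps every nonzero coordinate of \<open>a0\<close> and gains
      \<open>e1\<close>.\<close>
    moreover have "?supp a0 \<subset> ?supp ?b"
      using t e1 by auto
    then have "card (?supp a0) < card (?supp ?b)"
      using E by (intro psubset_card_mono) auto
    ultimately show False by simp
  qed
  have vanish: "vanishes_on_separator G L a"
    if a: "additive_on (bestvina_brady G) a" and supp: "\<forall>e\<in>E. a e \<noteq> 0 \<longrightarrow> a0 e \<noteq> 0" for a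
  proof -
    let ?I = "(\<lambda>(u, v). bb_diff G u v) ` mixed_pairs G L"
    have "finite ?I" using finite_mixed_pairs by simp
    moreover have "a0 i \<noteq> 0" if "i \<in> ?I" for i using that mix0 by auto
    ultimately obtain t where t: "t \<noteq> 0" "\<And>i. i \<in> ?I \<Longrightarrow> a0 i + t * a i \<noteq> 0"
      using generic_perturbation[of ?I a0 a] by blast
    let ?b = "\<lambda>x. a0 x + t * a x"
    have b: "additive_on (bestvina_brady G) ?b" using additive_linear(1)[OF add0 a, of 1 t] by simp
    have "?b (bb_diff G u v) = 0" if uv: "u \<in> verts L" "v \<in> verts L" for u v
    proof (cases "\<exists>x\<in>carrier (bestvina_brady G). ?b x \<noteq> 0")
      case True
      have "\<forall>e\<in>E. ?b e \<noteq> 0 \<longrightarrow> a0 e \<noteq> 0" using supp by auto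
      then have "resonant (bestvina_brady G) ?b" by (rule mono[OF generic_resonant[OF gen0] b True])
      then have "vanishes_on_separator G L ?b"
        by (rule resonant_vanishes_on_separator[OF _ b]) (use t(2) in force)
      then show ?thesis using uv by (simp add: vanishes_on_separator_def)
    next
      \<comment> \<open>\<open>mono\<close> requires a nonzero homomorphism; for the zero one the
        claim is immediate.\<close>
      case False
      then show ?thesis using bb_diff_carrier[OF G] uv separator_verts by blast
    qed
    then show ?thesis using t(1) van0 a by (simp add: vanishes_on_separator_def)
  qed
  show ?thesis
    by (rule that[OF add0]) (use supp_sub vanish in \<open>auto simp: vanishes_on_separator_def\<close>)
qed

end

text \<open>Coordinate subspaces would split the indicator homomorphism \<open>h\<close> as
  \<open>b\<close> plus \<open>?c\<close>, with \<open>b\<close> vanishing on \<open>L1\<close> and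
  \<open>?c\<close> on both \<open>L2\<close> and \<open>L3\<close>. Then \<open>b\<close> is 0 on
  the edge \<open>v2 v3\<close>, and \<open>?c\<close> is 0 on the other two edges of the triangle,
  hence on this one. But the indicator separates \<open>v2\<close> from \<open>v3\<close>.\<close>

theorem not_coordinate_resonance:
  assumes G: "graph G" and bi: "biconnected G"
    and sc: "simply_connected (realization (flag_complex G))"
    and red: "redundant_triangle G v1 v2 v3"
  shows "\<not> coordinate_resonance (bestvina_brady G)"
proof
  let ?B = "bestvina_brady G" and ?d = "bb_diff G"
  assume "coordinate_resonance ?B"
  then obtain E where E: "finite E"
    and restrict: "\<forall>a a'. additive_on ?B a \<longrightarrow> additive_on ?B a' \<longrightarrow>
        (\<exists>b :: _ \<Rightarrow> real. additive_on ?B b \<and> (\<forall>e\<in>E. b e = (if a' e = (0::real) then 0 else a e)))"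
    and mono: "\<forall>a a'. resonant ?B a \<longrightarrow> additive_on ?B a' \<longrightarrow> (\<exists>x\<in>carrier ?B. a' x \<noteq> 0) \<longrightarrow>
        (\<forall>e\<in>E. a' e \<noteq> 0 \<longrightarrow> a e \<noteq> 0) \<longrightarrow> resonant ?B a'"
    unfolding coordinate_resonance_def by - (elim exE conjE, rule that)
  obtain L1 L2 L3 where sub: "subgraph L1 (link G v1)" "subgraph L2 (link G v2)" "subgraph L3 (link G v3)"
    and e: "v2 \<rightarrow>\<^bsub>L1\<^esub> v3" "v1 \<rightarrow>\<^bsub>L2\<^esub> v3" "v1 \<rightarrow>\<^bsub>L3\<^esub> v2"
    and L: "minimal_full_separating G L1" "minimal_full_separating G L2" "minimal_full_separating G L3"
    and disj: "verts L1 \<inter> verts L2 \<inter> verts L3 = {}"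
    using red unfolding redundant_triangle_def by blast
  have mem: "u \<in> verts K \<and> v \<in> verts K" if "subgraph K (link G w)" "u \<rightarrow>\<^bsub>K\<^esub> v" for u v w K
  proof -
    interpret wf_digraph K using that(1) by (simp add: subgraph_def)
    show ?thesis using adj_in_verts[OF that(2)] by blast
  qed
  have v: "v2 \<in> verts L1" "v3 \<in> verts L1" "v1 \<in> verts L2" "v3 \<in> verts L2" "v1 \<in> verts L3" "v2 \<in> verts L3"
    using mem[OF sub(1) e(1)] mem[OF sub(2) e(2)] mem[OF sub(3) e(3)] by auto
  have VG: "verts L1 \<subseteq> verts G" "verts L2 \<subseteq> verts G" "verts L3 \<subseteq> verts G"
    using L by (auto simp: minimal_full_separating_def separating_def subgraph_def)
  have vG: "v1 \<in> verts G" "v2 \<in> verts G" "v3 \<in> verts G" using v VG by auto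
  have v2: "v2 \<notin> verts L2" using disj v by blast
  let ?W = "vanishes_on_separator G"
  have sep: "\<exists>a0 :: _ \<Rightarrow> real. additive_on ?B a0 \<and>
      (\<forall>a. ?W K a \<longleftrightarrow> additive_on ?B a \<and> (\<forall>e\<in>E. a e \<noteq> 0 \<longrightarrow> a0 e \<noteq> 0))"
    if "minimal_full_separating G K" "verts K \<noteq> {}" for K
  proof (rule separator_coordinate_subspace[OF G bi sc that E])
    fix a a' :: "_ \<Rightarrow> real"
    assume "resonant ?B a" "additive_on ?B a'" "\<exists>x\<in>carrier ?B. a' x \<noteq> 0"
      "\<forall>e\<in>E. a' e \<noteq> 0 \<longrightarrow> a e \<noteq> 0"
    then show "resonant ?B a'" using mono by blast
  next
    fix a0 :: "_ \<Rightarrow> real"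
    assume "additive_on ?B a0" and
      "\<And>a. ?W K a \<longleftrightarrow> additive_on ?B a \<and> (\<forall>e\<in>E. a e \<noteq> 0 \<longrightarrow> a0 e \<noteq> 0)"
    then show ?thesis by (intro exI[of _ a0] conjI allI)
  qed
  have ne: "verts L1 \<noteq> {}" "verts L2 \<noteq> {}" "verts L3 \<noteq> {}" using v by auto
  obtain a1 :: "_ \<Rightarrow> real" where a1: "additive_on ?B a1"
      "\<forall>a. ?W L1 a \<longleftrightarrow> additive_on ?B a \<and> (\<forall>e\<in>E. a e \<noteq> 0 \<longrightarrow> a1 e \<noteq> 0)"
    using sep[OF L(1) ne(1)] by - (elim exE conjE, rule that)
  obtain a2 :: "_ \<Rightarrow> real" where "additive_on ?B a2"
    and a2: "\<forall>a. ?W L2 a \<longleftrightarrow> additive_on ?B a \<and> (\<forall>e\<in>E. a e \<noteq> 0 \<longrightarrow> a2 e \<noteq> 0)"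
    using sep[OF L(2) ne(2)] by - (elim exE conjE, rule that)
  obtain a3 :: "_ \<Rightarrow> real" where "additive_on ?B a3"
    and a3: "\<forall>a. ?W L3 a \<longleftrightarrow> additive_on ?B a \<and> (\<forall>e\<in>E. a e \<noteq> 0 \<longrightarrow> a3 e \<noteq> 0)"
    using sep[OF L(3) ne(3)] by - (elim exE conjE, rule that)
  \<comment> \<open>As the triple intersection is empty, \<open>?f\<close> is 0 on
    \<open>L3\<close>. The summand \<open>?f1\<close> below is 0 on \<open>L1\<close>, and its sign
    makes \<open>?f - ?f1\<close> equal to 1 on all of \<open>L2\<close>.\<close>
  let ?f = "\<lambda>u. if u \<in> verts L1 \<inter> verts L2 then 1 else 0 :: real"
  let ?f1 = "\<lambda>u. if u \<in> verts L2 - verts L1 then - 1 else 0 :: real"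
  obtain h :: "_ \<Rightarrow> real" where h: "additive_on ?B h"
    and hd: "\<And>u v. u \<in> verts G \<Longrightarrow> v \<in> verts G \<Longrightarrow> h (?d u v) = ?f u - ?f v"
    using bb_hom_exists[OF G, of ?f] by blast
  obtain h1 :: "_ \<Rightarrow> real" where h1: "additive_on ?B h1"
    and h1d: "\<And>u v. u \<in> verts G \<Longrightarrow> v \<in> verts G \<Longrightarrow> h1 (?d u v) = ?f1 u - ?f1 v"
    using bb_hom_exists[OF G, of ?f1] by blast
  have wI: "?W K a" if "additive_on ?B a" "\<And>u v. u \<in> verts K \<Longrightarrow> v \<in> verts K \<Longrightarrow> a (?d u v) = 0"
    for K a using that by (simp add: vanishes_on_separator_def)
  have wD: "a (?d u v) = 0" if "?W K a" "u \<in> verts K" "v \<in> verts K" for K a u v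
    using that by (simp add: vanishes_on_separator_def)
  have "?W L1 h1"
    using VG(1) by (intro wI h1) (auto simp: h1d subset_iff)
  then have s1: "\<forall>e\<in>E. h1 e \<noteq> 0 \<longrightarrow> a1 e \<noteq> 0" by (rule a1(2)[THEN spec, THEN iffD1, THEN conjunct2])
  have "?W L2 (\<lambda>x. h x - h1 x)"
    using VG(2) by (intro wI additive_linear(2) h h1) (auto simp: h1d hd subset_iff)
  then have s2: "\<forall>e\<in>E. h e - h1 e \<noteq> 0 \<longrightarrow> a2 e \<noteq> 0"
    by (rule a2[THEN spec, THEN iffD1, THEN conjunct2])
  have "?W L3 h"
    using VG(3) disj by (intro wI h) (auto simp: hd subset_iff)
  then have s3: "\<forall>e\<in>E. h e \<noteq> 0 \<longrightarrow> a3 e \<noteq> 0"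
    by (rule a3[THEN spec, THEN iffD1, THEN conjunct2])
  \<comment> \<open>\<open>b\<close> keeps the coordinates of \<open>h\<close> in the support of
    \<open>a1\<close>. On the remaining ones \<open>h1\<close> is 0, so there \<open>h\<close>
    equals \<open>h - h1\<close>, which is supported where \<open>a2\<close> is nonzero.\<close>
  obtain b where b: "additive_on ?B b" "\<forall>e\<in>E. b e = (if a1 e = 0 then 0 else h e)"
    using restrict[rule_format, OF h a1(1)] by blast
  let ?c = "\<lambda>x. h x - b x"
  have c: "additive_on ?B ?c" by (intro additive_linear(2) h b(1))
  have supp_c: "\<forall>e\<in>E. ?c e \<noteq> 0 \<longrightarrow> a2 e \<noteq> 0 \<and> a3 e \<noteq> 0"
  proof (intro ballI impI)
    fix e assume e: "e \<in> E" "?c e \<noteq> 0"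
    then have "a1 e = 0" "h e \<noteq> 0" using b(2) by (auto split: if_splits)
    moreover have "h1 e = 0" using s1 e(1) \<open>a1 e = 0\<close> by blast
    ultimately show "a2 e \<noteq> 0 \<and> a3 e \<noteq> 0" using s2 s3 e(1) by simp
  qed
  have "\<forall>e\<in>E. b e \<noteq> 0 \<longrightarrow> a1 e \<noteq> 0" using b(2) by simp
  then have w1: "?W L1 b" by (intro a1(2)[THEN spec, THEN iffD2] conjI b(1))
  have w2: "?W L2 ?c" by (rule a2[THEN spec, THEN iffD2]) (use c supp_c in blast)
  have w3: "?W L3 ?c" by (rule a3[THEN spec, THEN iffD2]) (use c supp_c in blast)
  have "?c (?d v1 v2) + ?c (?d v2 v3) = ?c (?d v1 v3)"
    by (rule bb_additive_diff[OF G c vG])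
  then have "h (?d v2 v3) = 0"
    using wD[OF w1 v(1,2)] wD[OF w2 v(3,4)] wD[OF w3 v(5,6)] by simp
  then show False using hd[OF vG(2,3)] v v2 by simp
qed

theorem corollary4p45:
  fixes \<Gamma> :: "('a, 'b) pre_digraph"
    and \<Lambda> :: "('c, 'd) pre_digraph" and m :: "'c set \<Rightarrow> nat"
  assumes "graph \<Gamma>" and "biconnected \<Gamma>"
    and "simply_connected (realization (flag_complex \<Gamma>))"
    and "\<exists>v1 v2 v3. redundant_triangle \<Gamma> v1 v2 v3"
    and "labelled_graph \<Lambda> m"
  shows "\<not> bestvina_brady \<Gamma> \<cong> artin_group \<Lambda> m"
proof
  assume "bestvina_brady \<Gamma> \<cong> artin_group \<Lambda> m"
  then have "coordinate_resonance (bestvina_brady \<Gamma>)"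
    by (rule coordinate_resonance_iso[OF group_bestvina_brady _ coordinate_resonance_artin_group[OF assms(5)]])
  then show False using assms(4) not_coordinate_resonance[OF assms(1-3)] by blast
qed

end
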